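(* Under the assumptions in the context, $$\Phi^T\Phi=O_p(N),\qquad V^TV=O_p(N),\qquad \frac{\Phi^T\Phi}{N}-\Sigma=O_p(1/\sqrt N),\qquad \frac{\Phi^TV}{N}=O_p(1/\sqrt N),$$ $$\frac{V^TV}{N}-\sigma^2=O_p(1/\sqrt N),\qquad \hat\theta^{\mathrm{LS}}-\theta_0=O_p(1/\sqrt N),\qquad \widehat{\sigma^2}-\sigma^2=O_p(1/\sqrt N).$$
   Context: Fix an integer $n\ge1$. For each sample size $N>n$, let $\phi(t)=[u(t-1),\dots,u(t-n)]^T\in\mathbb R^n$ for $t=1,\dots,N$, $\Phi=[\phi(1),\dots,\phi(N)]^T\in\mathbb R^{N\times n}$, $V=[v(1),\dots,v(N)]^T$, and $Y=\Phi\theta_0+V$, where $u$ is the (random) input, $v$ the measurement noise and $\theta_0\in\mathbb R^n$ the fixed true parameter. $\Phi$ is assumed to have full column rank, $\mathrm{rank}(\Phi)=n$. The least squares estimator is $\hat\theta^{\mathrm{LS}}=(\Phi^T\Phi)^{-1}\Phi^TY$ and $\widehat{\sigma^2}=\|Y-\Phi\hat\theta^{\mathrm{LS}}\|_2^2/(N-n)$. Input assumption: $u(t)=\sum_{k=0}^\infty h(k)e(t-k)$ for $t\ge 1-n$, with real $h(k)$, $\sum_{k=0}^\infty|h(k)|<\infty$; $e(t)$ ($t\in\mathbb Z$) is i.i.d. with zero mean, variance $\sigma_e^2>0$, bounded moments of order $4+\delta$ for some $\delta>0$, and $\mathbb E[e^4(t)]=c\sigma_e^4$ with $c\in\mathbb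 R$ a constant. The covariance matrix $\Sigma\in\mathbb R^{n\times n}$ of $[u(0),u(1),\dots,u(n-1)]^T$ is positive definite. Noise assumption: $v(t)$, $t\ge1$, is i.i.d. with zero mean, variance $\sigma^2>0$ and bounded moments of order $4+\delta$ for some $\delta>0$. Independence assumption: the families $\{u(t)\}_{t\ge 1-n}$ and $\{v(t)\}_{t\ge1}$ are independent of each other. Notation: for a nonzero real sequence $\{a_N\}$, $\xi_N=O_p(a_N)$ means that for every $\epsilon>0$ there is $L>0$ with $\sup_N\Pr(\|\xi_N/a_N\|>L)<\epsilon$, where $\|\cdot\|$ is the Euclidean norm for vectors and Frobenius norm for matrices, and $N$ ranges over $N>n$. *)

theory Defs
  imports
    "HOL-Probability.Probability"
    "Jordan_Normal_Form.Gauss_Jordan_Elimination"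
    "Jordan_Normal_Form.DL_Rank"
begin

no_notation inner (infix "\<bullet>" 70)
no_notation vec_nth (infixl "$" 90)
hide_const (open) Finite_Cartesian_Product.vec Finite_Cartesian_Product.mat
hide_type (open) Finite_Cartesian_Product.vec

section \<open>Linear algebra\<close>

definition vec_norm :: "real vec \<Rightarrow> real" where
  "vec_norm x = L2_set (\<lambda>i. x $ i) {..<dim_vec x}"

definition frobenius_norm :: "real mat \<Rightarrow> real" where
  "frobenius_norm A = L2_set (\<lambda>ij. A $$ ij) ({..<dim_row A} \<times> {..<dim_col A})"

definition pos_def :: "nat \<Rightarrow> real mat \<Rightarrow> bool" where
  "pos_def n A \<longleftrightarrow> A \<in> carrier_mat n n \<and> A\<^sup>T = A \<and>
     (\<forall>x\<in>carrier_vec n. x \<noteq> 0\<^sub>v n \<longrightarrow> 0 < x \<bullet> (A *\<^sub>v x))"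

text \<open>The inverse as a total function; a singular square matrix is sent to the zero matrix.\<close>

definition mat_inv :: "real mat \<Rightarrow> real mat" where
  "mat_inv A = (case mat_inverse A of Some B \<Rightarrow> B | None \<Rightarrow> 0\<^sub>m (dim_row A) (dim_row A))"

section \<open>Probability\<close>

context prob_space
begin

definition iid :: "('i \<Rightarrow> 'a \<Rightarrow> real) \<Rightarrow> 'i set \<Rightarrow> bool" where
  "iid X I \<longleftrightarrow> indep_vars (\<lambda>_. borel) X I \<and>
     (\<forall>i\<in>I. \<forall>j\<in>I. distr M borel (X i) = distr M borel (X j))"

definition bounded_moments :: "real \<Rightarrow> ('i \<Rightarrow> 'a \<Rightarrow> real) \<Rightarrow> 'i set \<Rightarrow> bool" where
  "bounded_moments p X I \<longleftrightarrow>
     (\<exists>C. \<forall>i\<in>I. integrable M (\<lambda>\<omega>. \<bar>X i \<omega>\<bar> powr p) \<and> expectation (\<lambda>\<omega>. \<bar>X i \<omega>\<bar> powr p) \<le> C)"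

definition indep_families ::
    "('i \<Rightarrow> 'a \<Rightarrow> real) \<Rightarrow> 'i set \<Rightarrow> ('i \<Rightarrow> 'a \<Rightarrow> real) \<Rightarrow> 'i set \<Rightarrow> bool" where
  "indep_families X I Y J \<longleftrightarrow>
     indep_var (PiM I (\<lambda>_. borel)) (\<lambda>\<omega>. \<lambda>i\<in>I. X i \<omega>) (PiM J (\<lambda>_. borel)) (\<lambda>\<omega>. \<lambda>j\<in>J. Y j \<omega>)"

definition covariance :: "('a \<Rightarrow> real) \<Rightarrow> ('a \<Rightarrow> real) \<Rightarrow> real" where
  "covariance X Y = expectation (\<lambda>\<omega>. (X \<omega> - expectation X) * (Y \<omega> - expectation Y))"

definition covariance_mat :: "nat \<Rightarrow> (nat \<Rightarrow> 'a \<Rightarrow> real) \<Rightarrow> real mat" where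
  "covariance_mat n X = mat n n (\<lambda>(i, j). covariance (X i) (X j))"

text \<open>
  The measurability clause guarantees that the sets whose measure is taken are events: the measure
  of a non-measurable set is \<open>0\<close> by convention, so the bound alone could hold for the wrong reason.
\<close>

definition bounded_in_prob :: "nat set \<Rightarrow> (nat \<Rightarrow> 'a \<Rightarrow> real) \<Rightarrow> bool" where
  "bounded_in_prob S X \<longleftrightarrow>
     (\<forall>N\<in>S. random_variable borel (X N)) \<and>
     (\<forall>\<epsilon>>0. \<exists>L>0. (SUP N\<in>S. prob {\<omega> \<in> space M. X N \<omega> > L}) < \<epsilon>)"

text \<open>\<open>\<xi> N = O\<^sub>p(a N)\<close>, with \<open>N\<close> ranging over \<open>S\<close>, for scalars, vectors and matrices.\<close>

definition Op_real :: "nat set \<Rightarrow> (nat \<Rightarrow> 'a \<Rightarrow> real) \<Rightarrow> (nat \<Rightarrow> real) \<Rightarrow> bool" where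
  "Op_real S \<xi> a \<longleftrightarrow>
     (\<forall>N\<in>S. a N \<noteq> 0) \<and> bounded_in_prob S (\<lambda>N \<omega>. \<bar>\<xi> N \<omega> / a N\<bar>)"

definition Op_vec :: "nat set \<Rightarrow> (nat \<Rightarrow> 'a \<Rightarrow> real vec) \<Rightarrow> (nat \<Rightarrow> real) \<Rightarrow> bool" where
  "Op_vec S \<xi> a \<longleftrightarrow>
     (\<forall>N\<in>S. a N \<noteq> 0) \<and> bounded_in_prob S (\<lambda>N \<omega>. vec_norm ((1 / a N) \<cdot>\<^sub>v \<xi> N \<omega>))"

definition Op_mat :: "nat set \<Rightarrow> (nat \<Rightarrow> 'a \<Rightarrow> real mat) \<Rightarrow> (nat \<Rightarrow> real) \<Rightarrow> bool" where
  "Op_mat S \<xi> a \<longleftrightarrow>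
     (\<forall>N\<in>S. a N \<noteq> 0) \<and> bounded_in_prob S (\<lambda>N \<omega>. frobenius_norm ((1 / a N) \<cdot>\<^sub>m \<xi> N \<omega>))"

end

section \<open>The linear regression model\<close>

text \<open>Vector and matrix entries are indexed from 0, whereas the sample times are \<open>1, \<dots>, N\<close>.\<close>

definition regressor :: "nat \<Rightarrow> (int \<Rightarrow> 'a \<Rightarrow> real) \<Rightarrow> nat \<Rightarrow> 'a \<Rightarrow> real vec" where
  "regressor n u t \<omega> = vec n (\<lambda>i. u (int t - int (i + 1)) \<omega>)"

definition regressor_mat :: "nat \<Rightarrow> (int \<Rightarrow> 'a \<Rightarrow> real) \<Rightarrow> nat \<Rightarrow> 'a \<Rightarrow> real mat" where
  "regressor_mat n u N \<omega> = mat_of_rows n (map (\<lambda>t. regressor n u t \<omega>) [1..<N+1])"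

definition noise_vec :: "(int \<Rightarrow> 'a \<Rightarrow> real) \<Rightarrow> nat \<Rightarrow> 'a \<Rightarrow> real vec" where
  "noise_vec v N \<omega> = vec N (\<lambda>i. v (int (i + 1)) \<omega>)"

definition ls_estimator :: "real mat \<Rightarrow> real vec \<Rightarrow> real vec" where
  "ls_estimator \<Phi> Y = (mat_inv (\<Phi>\<^sup>T * \<Phi>) * \<Phi>\<^sup>T) *\<^sub>v Y"

definition noise_var_estimator :: "real mat \<Rightarrow> real vec \<Rightarrow> real" where
  "noise_var_estimator \<Phi> Y =
     (vec_norm (Y - \<Phi> *\<^sub>v ls_estimator \<Phi> Y))\<^sup>2 / (real (dim_row \<Phi>) - real (dim_col \<Phi>))"

end

theory Submission
  imports Defs
begin

text \<open>
  All seven rates come from second moment bounds followed by Chebyshev's inequality: a sum of \<open>N\<close>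
  centred terms whose second moment grows at most linearly in \<open>N\<close> is \<open>O\<^sub>p(\<surd>N)\<close>. The terms
  \<open>v(t)\<^sup>2 - \<sigma>\<^sup>2\<close> are pairwise uncorrelated, and so are the terms \<open>u(t - i) v(t)\<close>, because the noise
  is white and independent of the input; here the second moments simply add up.

  The terms \<open>u(t - i) u(t - j) - E[u(t - i) u(t - j)]\<close> are correlated, so the sample covariance of the
  input is expanded in the innovations: it is a combination, with weights \<open>h(k) h(l)\<close>, of sums over
  \<open>t\<close> of \<open>e(t - i - k) e(t - j - l)\<close>, centred. For fixed lags these summands are again pairwise
  uncorrelated, because among the four time indices involved one always occurs alone. A weighted
  Cauchy-Schwarz inequality then gives a bound proportional to \<open>N\<close>, with the constant
  \<open>(\<Sum>k. \<bar>h k\<bar>)\<^sup>4\<close> times a fourth moment bound. The expansion is an infinite series, so the estimate is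
  first made for truncated filters, where it does not depend on the truncation, and is carried to the
  limit by Fatou's lemma (\<open>sample_autocov\<close>). Dominated convergence identifies the limits of the
  covariances of the truncated process as those of \<open>u\<close>, which hence depend on the lag only.

  For the estimator put \<open>d = \<theta>LS - \<theta>\<^sub>0\<close> and \<open>G = \<Phi>\<^sup>T \<Phi> / N\<close>, and let \<open>B\<close> be the inverse of \<open>\<Sigma>\<close>. As soon as
  \<open>\<parallel>B\<parallel> \<parallel>G - \<Sigma>\<parallel> \<le> 1/2\<close>, the matrix \<open>G\<close> is invertible, \<open>G d = \<Phi>\<^sup>T V / N\<close>, and a perturbation argument gives
  \<open>\<parallel>d\<parallel> \<le> 2 \<parallel>B\<parallel> \<parallel>\<Phi>\<^sup>T V / N\<parallel>\<close> (\<open>ls_estimator_error_bound\<close>). Since \<open>G - \<Sigma>\<close> tends to zero in probability, this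
  event has probability close to one for all large \<open>N\<close>; the finitely many remaining \<open>N\<close> do no harm,
  because a single random variable is always bounded in probability
  (\<open>bounded_in_prob_dominated_whp\<close>). What this last step asks for is that \<open>\<theta>LS\<close> is
  measurable, which follows by writing the inverse matrix through the adjugate and the determinant.
  Finally, the residual sum of squares is \<open>V\<^sup>T V - 2 d\<^sup>T \<Phi>\<^sup>T V + N d\<^sup>T G d\<close>, in which the last two terms are
  bounded in probability, so that the noise variance estimator inherits the rate of \<open>V\<^sup>T V / N\<close>.
\<close>

section \<open>Boundedness in probability\<close>

context prob_space
begin

lemma bounded_in_prob_measurable:
  "bounded_in_prob S X \<Longrightarrow> N \<in> S \<Longrightarrow> random_variable borel (X N)"
  by (simp add: bounded_in_prob_def)

lemma bounded_in_probD:
  assumes "bounded_in_prob S X" "0 < \<epsilon>"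
  obtains L where "0 < L" "\<And>N. N \<in> S \<Longrightarrow> prob {\<omega> \<in> space M. X N \<omega> > L} < \<epsilon>"
proof -
  obtain L where L: "0 < L" "(SUP N\<in>S. prob {\<omega> \<in> space M. X N \<omega> > L}) < \<epsilon>"
    using assms by (auto simp: bounded_in_prob_def)
  have "prob {\<omega> \<in> space M. X N \<omega> > L} < \<epsilon>" if "N \<in> S" for N
  proof -
    have "bdd_above ((\<lambda>N. prob {\<omega> \<in> space M. X N \<omega> > L}) ` S)"
      by (rule bdd_aboveI[of _ 1]) auto
    then have "prob {\<omega> \<in> space M. X N \<omega> > L} \<le> (SUP N\<in>S. prob {\<omega> \<in> space M. X N \<omega> > L})"
      using that by (rule cSUP_upper[rotated])
    then show ?thesis using L by simp
  qed
  then show ?thesis using L that by blast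
qed

text \<open>A single random variable is tight: the events \<open>X > k\<close> decrease to the empty set.\<close>

lemma tail_prob_small:
  assumes [measurable]: "random_variable borel X" and "0 < \<epsilon>"
  obtains L :: real where "prob {\<omega> \<in> space M. X \<omega> > L} \<le> \<epsilon>"
proof -
  define A where "A = (\<lambda>k::nat. {\<omega> \<in> space M. X \<omega> > real k})"
  have "range A \<subseteq> sets M" by (auto simp: A_def)
  moreover have "decseq A" by (auto simp: A_def decseq_def)
  ultimately have "(\<lambda>k. prob (A k)) \<longlonglongrightarrow> prob (\<Inter>k. A k)"
    by (rule finite_Lim_measure_decseq)
  moreover have "(\<Inter>k. A k) = {}"
  proof -
    have "\<exists>k. \<not> X \<omega> > real k" for \<omega>
      using real_arch_simple[of "X \<omega>"] by (simp add: not_less)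
    then show ?thesis by (auto simp: A_def)
  qed
  ultimately have "(\<lambda>k. prob (A k)) \<longlonglongrightarrow> 0" by simp
  then have "\<forall>\<^sub>F k in sequentially. prob (A k) < \<epsilon>"
    using \<open>0 < \<epsilon>\<close> by (rule order_tendstoD)
  then obtain k where "prob (A k) < \<epsilon>" by (auto simp: eventually_sequentially)
  then show ?thesis using that[of "real k"] by (simp add: A_def)
qed

text \<open>
  It is enough to control the tails for large indices: each of the finitely many others has its own
  level, and the maximum of all these levels works uniformly.
\<close>

lemma bounded_in_probI_eventually:
  assumes "S \<noteq> {}" and [measurable]: "\<And>N. N \<in> S \<Longrightarrow> random_variable borel (X N)"
    and ev: "\<And>\<epsilon>. 0 < \<epsilon> \<Longrightarrow>
      \<exists>L N\<^sub>0. \<forall>N\<in>S. N\<^sub>0 \<le> N \<longrightarrow> prob {\<omega> \<in> space M. X N \<omega> > L} \<le> \<epsilon>"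
  shows "bounded_in_prob S X"
  unfolding bounded_in_prob_def
proof (intro conjI ballI allI impI)
  fix \<epsilon> :: real assume \<epsilon>: "0 < \<epsilon>"
  then have "0 < \<epsilon> / 2" by simp
  from ev[OF this] obtain L N\<^sub>0 where L: "\<And>N. N \<in> S \<Longrightarrow> N\<^sub>0 \<le> N \<Longrightarrow>
      prob {\<omega> \<in> space M. X N \<omega> > L} \<le> \<epsilon> / 2"
    by blast
  have "\<exists>l. prob {\<omega> \<in> space M. X N \<omega> > l} \<le> \<epsilon> / 2" if "N \<in> S" for N
    using tail_prob_small[OF assms(2)[OF that] \<open>0 < \<epsilon> / 2\<close>] by blast
  then obtain l where l: "\<And>N. N \<in> S \<Longrightarrow> prob {\<omega> \<in> space M. X N \<omega> > l N} \<le> \<epsilon> / 2"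
    by metis
  define K where "K = Max (insert 1 (insert L (l ` {..<N\<^sub>0})))"
  have fin: "finite (insert 1 (insert L (l ` {..<N\<^sub>0})))"
    by simp
  have "1 \<le> K" "L \<le> K" and lK: "\<And>N. N < N\<^sub>0 \<Longrightarrow> l N \<le> K"
    unfolding K_def by (rule Max_ge[OF fin], simp)+
  have "prob {\<omega> \<in> space M. X N \<omega> > K} \<le> \<epsilon> / 2" if N: "N \<in> S" for N
  proof -
    define k where "k = (if N < N\<^sub>0 then l N else L)"
    have "k \<le> K" using lK \<open>L \<le> K\<close> by (simp add: k_def)
    then have "prob {\<omega> \<in> space M. X N \<omega> > K} \<le> prob {\<omega> \<in> space M. X N \<omega> > k}"
      using N by (intro finite_measure_mono) auto
    also have "\<dots> \<le> \<epsilon> / 2" using L l N by (simp add: k_def)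
    finally show ?thesis .
  qed
  then have "(SUP N\<in>S. prob {\<omega> \<in> space M. X N \<omega> > K}) \<le> \<epsilon> / 2"
    using \<open>S \<noteq> {}\<close> by (intro cSUP_least) auto
  then show "\<exists>L>0. (SUP N\<in>S. prob {\<omega> \<in> space M. X N \<omega> > L}) < \<epsilon>"
    using \<epsilon> \<open>1 \<le> K\<close> by (intro exI[of _ K] conjI) linarith+
qed (rule assms(2))

text \<open>
  The comparison may fail on events whose probability tends to zero. This is what allows a bound for
  the estimator that holds only where the sample covariance is close to its limit.
\<close>

lemma bounded_in_prob_dominated_whp:
  assumes "S \<noteq> {}" and X[measurable]: "\<And>N. N \<in> S \<Longrightarrow> random_variable borel (X N)"
    and Y: "bounded_in_prob S Y"
    and whp: "\<And>\<epsilon>. 0 < \<epsilon> \<Longrightarrow>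
      \<exists>N\<^sub>0. \<forall>N\<in>S. N\<^sub>0 \<le> N \<longrightarrow> prob {\<omega> \<in> space M. X N \<omega> > Y N \<omega>} \<le> \<epsilon>"
  shows "bounded_in_prob S X"
proof (rule bounded_in_probI_eventually[OF assms(1,2)])
  fix \<epsilon> :: real assume "0 < \<epsilon>"
  then have "0 < \<epsilon> / 2" by simp
  from whp[OF this] obtain N\<^sub>0 where N\<^sub>0:
    "\<And>N. N \<in> S \<Longrightarrow> N\<^sub>0 \<le> N \<Longrightarrow> prob {\<omega> \<in> space M. X N \<omega> > Y N \<omega>} \<le> \<epsilon> / 2"
    by blast
  from bounded_in_probD[OF Y \<open>0 < \<epsilon> / 2\<close>] obtain L where L:
    "\<And>N. N \<in> S \<Longrightarrow> prob {\<omega> \<in> space M. Y N \<omega> > L} < \<epsilon> / 2"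
    by blast
  have "prob {\<omega> \<in> space M. X N \<omega> > L} \<le> \<epsilon>" if N: "N \<in> S" "N\<^sub>0 \<le> N" for N
  proof -
    note [measurable] = X[OF N(1)] bounded_in_prob_measurable[OF Y N(1)]
    have "prob {\<omega> \<in> space M. X N \<omega> > L}
        \<le> prob ({\<omega> \<in> space M. X N \<omega> > Y N \<omega>} \<union> {\<omega> \<in> space M. Y N \<omega> > L})"
      by (intro finite_measure_mono) auto
    also have "\<dots> \<le> prob {\<omega> \<in> space M. X N \<omega> > Y N \<omega>} + prob {\<omega> \<in> space M. Y N \<omega> > L}"
      by (intro measure_Un_le) auto
    also have "\<dots> \<le> \<epsilon>" using N\<^sub>0[OF N] L[OF N(1)] by simp
    finally show ?thesis .
  qed
  then show "\<exists>L N\<^sub>0. \<forall>N\<in>S. N\<^sub>0 \<le> N \<longrightarrow> prob {\<omega> \<in> space M. X N \<omega> > L} \<le> \<epsilon>"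
    by blast
qed

lemma bounded_in_prob_mono:
  assumes "S \<noteq> {}" "\<And>N. N \<in> S \<Longrightarrow> random_variable borel (X N)" "bounded_in_prob S Y"
    and le: "\<And>N \<omega>. N \<in> S \<Longrightarrow> \<omega> \<in> space M \<Longrightarrow> X N \<omega> \<le> Y N \<omega>"
  shows "bounded_in_prob S X"
proof (rule bounded_in_prob_dominated_whp[OF assms(1-3)])
  fix \<epsilon> :: real assume "0 < \<epsilon>"
  moreover have "prob {\<omega> \<in> space M. X N \<omega> > Y N \<omega>} = 0" if "N \<in> S" for N
  proof -
    have "{\<omega> \<in> space M. X N \<omega> > Y N \<omega>} = {}"
      using le[OF that] by (auto simp: not_less)
    then show ?thesis by (simp only: measure_empty)
  qed
  ultimately show "\<exists>N\<^sub>0. \<forall>N\<in>S. N\<^sub>0 \<le> N \<longrightarrow> prob {\<omega> \<in> space M. X N \<omega> > Y N \<omega>} \<le> \<epsilon>"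
    by simp
qed

lemma bounded_in_prob_const:
  assumes "S \<noteq> {}" shows "bounded_in_prob S (\<lambda>_ _. c)"
proof (rule bounded_in_probI_eventually[OF assms])
  show "\<exists>L N\<^sub>0. \<forall>N\<in>S. N\<^sub>0 \<le> N \<longrightarrow> prob {\<omega> \<in> space M. c > L} \<le> \<epsilon>" if "0 < \<epsilon>" for \<epsilon> :: real
    using that by (intro exI[of _ c]) auto
qed simp

text \<open>The common core of closure under sums and products: \<open>Z\<close> can only be large where \<open>X\<close> or \<open>Y\<close> is.\<close>

lemma bounded_in_prob_combine:
  assumes "S \<noteq> {}" and X: "bounded_in_prob S X" and Y: "bounded_in_prob S Y"
    and Z: "\<And>N. N \<in> S \<Longrightarrow> random_variable borel (Z N)"
    and le: "\<And>a b. 0 < a \<Longrightarrow> 0 < b \<Longrightarrow> \<exists>L. \<forall>N\<in>S. \<forall>\<omega>\<in>space M.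
      X N \<omega> \<le> a \<longrightarrow> Y N \<omega> \<le> b \<longrightarrow> Z N \<omega> \<le> L"
  shows "bounded_in_prob S Z"
proof (rule bounded_in_probI_eventually[OF assms(1) Z])
  fix \<epsilon> :: real assume "0 < \<epsilon>"
  then have "0 < \<epsilon> / 2" by simp
  from bounded_in_probD[OF X this] obtain a where a: "0 < a"
    "\<And>N. N \<in> S \<Longrightarrow> prob {\<omega> \<in> space M. X N \<omega> > a} < \<epsilon> / 2" by blast
  from bounded_in_probD[OF Y \<open>0 < \<epsilon> / 2\<close>] obtain b where b: "0 < b"
    "\<And>N. N \<in> S \<Longrightarrow> prob {\<omega> \<in> space M. Y N \<omega> > b} < \<epsilon> / 2" by blast
  from le[OF a(1) b(1)] obtain L where L:
    "\<And>N \<omega>. N \<in> S \<Longrightarrow> \<omega> \<in> space M \<Longrightarrow> X N \<omega> \<le> a \<Longrightarrow> Y N \<omega> \<le> b \<Longrightarrow> Z N \<omega> \<le> L"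
    by blast
  have "prob {\<omega> \<in> space M. Z N \<omega> > L} \<le> \<epsilon>" if N: "N \<in> S" for N
  proof -
    note [measurable] = bounded_in_prob_measurable[OF X N] bounded_in_prob_measurable[OF Y N]
    have "prob {\<omega> \<in> space M. Z N \<omega> > L}
        \<le> prob ({\<omega> \<in> space M. X N \<omega> > a} \<union> {\<omega> \<in> space M. Y N \<omega> > b})"
      using L[OF N] by (intro finite_measure_mono) (auto simp: not_less[symmetric])
    also have "\<dots> \<le> prob {\<omega> \<in> space M. X N \<omega> > a} + prob {\<omega> \<in> space M. Y N \<omega> > b}"
      by (intro measure_Un_le) auto
    also have "\<dots> \<le> \<epsilon>" using a(2)[OF N] b(2)[OF N] by simp
    finally show ?thesis .
  qed
  then show "\<exists>L N\<^sub>0. \<forall>N\<in>S. N\<^sub>0 \<le> N \<longrightarrow> prob {\<omega> \<in> space M. Z N \<omega> > L} \<le> \<epsilon>"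
    by blast
qed

lemma bounded_in_prob_add:
  assumes "S \<noteq> {}" and X: "bounded_in_prob S X" and Y: "bounded_in_prob S Y"
  shows "bounded_in_prob S (\<lambda>N \<omega>. X N \<omega> + Y N \<omega>)"
proof (rule bounded_in_prob_combine[OF assms])
  show "random_variable borel (\<lambda>\<omega>. X N \<omega> + Y N \<omega>)" if "N \<in> S" for N
    using bounded_in_prob_measurable[OF X that] bounded_in_prob_measurable[OF Y that] by simp
  show "\<exists>L. \<forall>N\<in>S. \<forall>\<omega>\<in>space M. X N \<omega> \<le> a \<longrightarrow> Y N \<omega> \<le> b \<longrightarrow> X N \<omega> + Y N \<omega> \<le> L" for a b
    by (intro exI[of _ "a + b"]) auto
qed

lemma bounded_in_prob_mult:
  assumes "S \<noteq> {}" and X: "bounded_in_prob S X" and Y: "bounded_in_prob S Y"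
    and nn: "\<And>N \<omega>. N \<in> S \<Longrightarrow> 0 \<le> X N \<omega>" "\<And>N \<omega>. N \<in> S \<Longrightarrow> 0 \<le> Y N \<omega>"
  shows "bounded_in_prob S (\<lambda>N \<omega>. X N \<omega> * Y N \<omega>)"
proof (rule bounded_in_prob_combine[OF assms(1-3)])
  show "random_variable borel (\<lambda>\<omega>. X N \<omega> * Y N \<omega>)" if "N \<in> S" for N
    using bounded_in_prob_measurable[OF X that] bounded_in_prob_measurable[OF Y that] by simp
  show "\<exists>L. \<forall>N\<in>S. \<forall>\<omega>\<in>space M. X N \<omega> \<le> a \<longrightarrow> Y N \<omega> \<le> b \<longrightarrow> X N \<omega> * Y N \<omega> \<le> L"
    if "0 < a" "0 < b" for a b
    using that nn by (intro exI[of _ "a * b"]) (auto intro!: mult_mono)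
qed

lemma bounded_in_prob_sum:
  assumes "S \<noteq> {}" "finite I" "\<And>i. i \<in> I \<Longrightarrow> bounded_in_prob S (X i)"
  shows "bounded_in_prob S (\<lambda>N \<omega>. \<Sum>i\<in>I. X i N \<omega>)"
  using assms(2,3)
  by (induction rule: finite_induct)
     (simp_all add: bounded_in_prob_add[OF assms(1)] bounded_in_prob_const[OF assms(1)])

text \<open>Chebyshev's inequality, uniformly in \<open>N\<close>.\<close>

lemma bounded_in_prob_second_moment:
  assumes "S \<noteq> {}" and X: "\<And>N. N \<in> S \<Longrightarrow> random_variable borel (X N)"
    and int: "\<And>N. N \<in> S \<Longrightarrow> integrable M (\<lambda>\<omega>. (X N \<omega>)\<^sup>2)"
    and bound: "\<And>N. N \<in> S \<Longrightarrow> expectation (\<lambda>\<omega>. (X N \<omega>)\<^sup>2) \<le> C"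
  shows "bounded_in_prob S (\<lambda>N \<omega>. \<bar>X N \<omega>\<bar>)"
proof (rule bounded_in_probI_eventually[OF assms(1)])
  fix \<epsilon> :: real assume \<epsilon>: "0 < \<epsilon>"
  \<comment> \<open>\<open>\<bar>C\<bar> + 1\<close> instead of \<open>C\<close> keeps the level positive when \<open>C = 0\<close>.\<close>
  define L where "L = sqrt ((\<bar>C\<bar> + 1) / \<epsilon>)"
  have L: "0 < L" "L\<^sup>2 = (\<bar>C\<bar> + 1) / \<epsilon>" using \<epsilon> by (auto simp: L_def)
  have "prob {\<omega> \<in> space M. \<bar>X N \<omega>\<bar> > L} \<le> \<epsilon>" if N: "N \<in> S" for N
  proof -
    note [measurable] = X[OF N]
    have "prob {\<omega> \<in> space M. \<bar>X N \<omega>\<bar> > L} \<le> prob {\<omega> \<in> space M. (X N \<omega>)\<^sup>2 \<ge> L\<^sup>2}"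
      using L(1) by (intro finite_measure_mono) (auto simp flip: abs_le_square_iff)
    also have "\<dots> \<le> expectation (\<lambda>\<omega>. (X N \<omega>)\<^sup>2) / L\<^sup>2"
      using L(1) by (intro integral_Markov_inequality_measure[OF int[OF N], of "{}"]) auto
    also have "\<dots> \<le> (\<bar>C\<bar> + 1) / L\<^sup>2"
      using bound[OF N] by (intro divide_right_mono) auto
    also have "\<dots> = \<epsilon>" using \<epsilon> by (simp add: L field_simps add_pos_nonneg)
    finally show ?thesis .
  qed
  then show "\<exists>L N\<^sub>0. \<forall>N\<in>S. N\<^sub>0 \<le> N \<longrightarrow> prob {\<omega> \<in> space M. \<bar>X N \<omega>\<bar> > L} \<le> \<epsilon>" by blast
qed (use X in auto)

lemma bounded_in_prob_scaled_imp_small_whp: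
  assumes X: "bounded_in_prob S (\<lambda>N \<omega>. r N * X N \<omega>)" and r: "filterlim r at_top sequentially"
    and "0 < c" "0 < \<epsilon>"
  shows "\<exists>N\<^sub>0. \<forall>N\<in>S. N\<^sub>0 \<le> N \<longrightarrow> prob {\<omega> \<in> space M. X N \<omega> > c} \<le> \<epsilon>"
proof -
  from bounded_in_probD[OF X \<open>0 < \<epsilon>\<close>] obtain L where L:
    "0 < L" "\<And>N. N \<in> S \<Longrightarrow> prob {\<omega> \<in> space M. r N * X N \<omega> > L} < \<epsilon>" by blast
  from r have "\<forall>\<^sub>F N in sequentially. L / c \<le> r N"
    by (simp add: filterlim_at_top)
  then obtain N\<^sub>0 where N\<^sub>0: "\<And>N. N\<^sub>0 \<le> N \<Longrightarrow> L / c \<le> r N"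
    by (auto simp: eventually_sequentially)
  have "prob {\<omega> \<in> space M. X N \<omega> > c} \<le> \<epsilon>" if N: "N \<in> S" "N\<^sub>0 \<le> N" for N
  proof -
    have "0 < L / c" using L(1) \<open>0 < c\<close> by simp
    then have rN: "L \<le> r N * c" "0 < r N"
      using N\<^sub>0[OF N(2)] \<open>0 < c\<close> by (simp add: field_simps, linarith)
    have rX: "L < r N * X N \<omega>" if "c < X N \<omega>" for \<omega>
      using mult_strict_left_mono[OF that rN(2)] rN(1) by linarith
    have "prob {\<omega> \<in> space M. X N \<omega> > c} \<le> prob {\<omega> \<in> space M. r N * X N \<omega> > L}"
      using rX bounded_in_prob_measurable[OF X N(1)]
      by (intro finite_measure_mono) auto
    then show ?thesis using L(2)[OF N(1)] by simp
  qed
  then show ?thesis by blast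
qed

end

section \<open>Moments and white noise\<close>

text \<open>
  Cauchy-Schwarz after splitting \<open>\<bar>w\<bar>\<close> as \<open>\<surd>\<bar>w\<bar> \<sqdot> \<surd>\<bar>w\<bar>\<close>. If the second moments of the \<open>x k\<close> have a common
  bound \<open>D\<close>, it bounds that of the combination by \<open>D\<close> times the squared sum of the \<open>\<bar>w k\<bar>\<close>, which is
  why absolute summability of the filter is the right condition.
\<close>

lemma weighted_Cauchy_Schwarz:
  fixes w x :: "'b \<Rightarrow> real"
  shows "(\<Sum>k\<in>A. w k * x k)\<^sup>2 \<le> (\<Sum>k\<in>A. \<bar>w k\<bar>) * (\<Sum>k\<in>A. \<bar>w k\<bar> * (x k)\<^sup>2)"
proof -
  have "(\<Sum>k\<in>A. w k * x k) = (\<Sum>k\<in>A. sqrt \<bar>w k\<bar> * (sgn (w k) * sqrt \<bar>w k\<bar> * x k))"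
    by (intro sum.cong refl) (simp add: mult_ac abs_sgn_eq sgn_real_def)
  also have "\<dots>\<^sup>2 \<le> (\<Sum>k\<in>A. (sqrt \<bar>w k\<bar>)\<^sup>2) * (\<Sum>k\<in>A. (sgn (w k) * sqrt \<bar>w k\<bar> * x k)\<^sup>2)"
    by (rule Cauchy_Schwarz_ineq_sum)
  also have "(\<Sum>k\<in>A. (sgn (w k) * sqrt \<bar>w k\<bar> * x k)\<^sup>2) = (\<Sum>k\<in>A. \<bar>w k\<bar> * (x k)\<^sup>2)"
    by (intro sum.cong refl) (simp add: power_mult_distrib sgn_real_def)
  finally show ?thesis by simp
qed

lemma abs_mult4_le:
  fixes x y z w :: real
  shows "\<bar>x * y * z * w\<bar> \<le> x ^ 4 + y ^ 4 + z ^ 4 + w ^ 4"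
proof -
  have ab: "2 * \<bar>a * b\<bar> \<le> a\<^sup>2 + b\<^sup>2" for a b :: real
    using zero_le_power2[of "\<bar>a\<bar> - \<bar>b\<bar>"] by (simp add: power2_diff abs_mult)
  have "2 * \<bar>x * y * z * w\<bar> \<le> (x * y)\<^sup>2 + (z * w)\<^sup>2"
    using ab[of "x * y" "z * w"] by (simp add: mult.assoc)
  moreover have "2 * (x * y)\<^sup>2 \<le> x ^ 4 + y ^ 4" "2 * (z * w)\<^sup>2 \<le> z ^ 4 + w ^ 4"
    using ab[of "x\<^sup>2" "y\<^sup>2"] ab[of "z\<^sup>2" "w\<^sup>2"] by (simp_all add: power_mult_distrib)
  moreover have "0 \<le> x ^ 4" "0 \<le> y ^ 4" "0 \<le> z ^ 4" "0 \<le> w ^ 4" by simp_all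
  ultimately show ?thesis by linarith
qed

context prob_space
begin

lemma integrable_mult4:
  fixes X Y Z W :: "'a \<Rightarrow> real"
  assumes [measurable]: "random_variable borel X" "random_variable borel Y"
      "random_variable borel Z" "random_variable borel W"
    and "integrable M (\<lambda>\<omega>. X \<omega> ^ 4)" "integrable M (\<lambda>\<omega>. Y \<omega> ^ 4)"
      "integrable M (\<lambda>\<omega>. Z \<omega> ^ 4)" "integrable M (\<lambda>\<omega>. W \<omega> ^ 4)"
  shows "integrable M (\<lambda>\<omega>. X \<omega> * Y \<omega> * Z \<omega> * W \<omega>)"
proof (rule Bochner_Integration.integrable_bound)
  show "integrable M (\<lambda>\<omega>. X \<omega> ^ 4 + Y \<omega> ^ 4 + Z \<omega> ^ 4 + W \<omega> ^ 4)"
    using assms by simp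
  show "AE \<omega> in M. norm (X \<omega> * Y \<omega> * Z \<omega> * W \<omega>) \<le> norm (X \<omega> ^ 4 + Y \<omega> ^ 4 + Z \<omega> ^ 4 + W \<omega> ^ 4)"
    using abs_mult4_le by (intro AE_I2) (simp add: order_trans[OF _ abs_ge_self])
qed simp

lemma bounded_moments_fourth:
  assumes "bounded_moments (4 + \<delta>) X I" "0 < \<delta>"
    and X: "\<And>i. i \<in> I \<Longrightarrow> random_variable borel (X i)"
  obtains C where "\<And>i. i \<in> I \<Longrightarrow> integrable M (\<lambda>\<omega>. X i \<omega> ^ 4)"
    and "\<And>i. i \<in> I \<Longrightarrow> expectation (\<lambda>\<omega>. X i \<omega> ^ 4) \<le> C"
proof -
  obtain C where C: "\<And>i. i \<in> I \<Longrightarrow> integrable M (\<lambda>\<omega>. \<bar>X i \<omega>\<bar> powr (4 + \<delta>))"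
    "\<And>i. i \<in> I \<Longrightarrow> expectation (\<lambda>\<omega>. \<bar>X i \<omega>\<bar> powr (4 + \<delta>)) \<le> C"
    using assms(1) by (auto simp: bounded_moments_def)
  have pw: "x ^ 4 \<le> 1 + \<bar>x\<bar> powr (4 + \<delta>)" for x :: real
  proof (cases "\<bar>x\<bar> \<le> 1")
    case True
    then have "\<bar>x\<bar> ^ 4 \<le> 1" by (intro power_le_one) auto
    then show ?thesis by (simp add: power_even_abs add_increasing2)
  next
    case False
    then have "\<bar>x\<bar> powr 4 \<le> \<bar>x\<bar> powr (4 + \<delta>)" using assms(2) by (intro powr_mono) auto
    moreover have "\<bar>x\<bar> powr 4 = x ^ 4" using False by (subst powr_numeral) (auto simp: power_even_abs)
    ultimately show ?thesis by simp
  qed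
  have int: "integrable M (\<lambda>\<omega>. X i \<omega> ^ 4)" if i: "i \<in> I" for i
  proof (rule Bochner_Integration.integrable_bound)
    show "integrable M (\<lambda>\<omega>. 1 + \<bar>X i \<omega>\<bar> powr (4 + \<delta>))" using C(1)[OF i] by simp
    show "AE \<omega> in M. norm (X i \<omega> ^ 4) \<le> norm (1 + \<bar>X i \<omega>\<bar> powr (4 + \<delta>))"
      using pw by (intro AE_I2) (simp add: order_trans[OF _ abs_ge_self])
  qed (use X[OF i] in simp)
  moreover have "expectation (\<lambda>\<omega>. X i \<omega> ^ 4) \<le> 1 + C" if i: "i \<in> I" for i
  proof -
    have "expectation (\<lambda>\<omega>. X i \<omega> ^ 4) \<le> expectation (\<lambda>\<omega>. 1 + \<bar>X i \<omega>\<bar> powr (4 + \<delta>))"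
      using int[OF i] C(1)[OF i] pw by (intro integral_mono) auto
    also have "\<dots> \<le> 1 + C" using C[OF i] by (simp add: prob_space)
    finally show ?thesis .
  qed
  ultimately show ?thesis using that by blast
qed

text \<open>
  Pythagoras: only the diagonal of the double sum contributes, which turns \<open>card A\<close> squared into
  \<open>card A\<close>. Every \<open>1/\<surd>N\<close> rate below rests on this lemma.
\<close>

lemma second_moment_orthogonal_sum:
  fixes Z :: "'b \<Rightarrow> 'a \<Rightarrow> real" and C :: real
  assumes A: "finite A"
    and int: "\<And>s t. s \<in> A \<Longrightarrow> t \<in> A \<Longrightarrow> integrable M (\<lambda>\<omega>. Z s \<omega> * Z t \<omega>)"
    and orth: "\<And>s t. s \<in> A \<Longrightarrow> t \<in> A \<Longrightarrow> s \<noteq> t \<Longrightarrow> expectation (\<lambda>\<omega>. Z s \<omega> * Z t \<omega>) = 0"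
    and bound: "\<And>t. t \<in> A \<Longrightarrow> expectation (\<lambda>\<omega>. (Z t \<omega>)\<^sup>2) \<le> C"
  shows "integrable M (\<lambda>\<omega>. (\<Sum>t\<in>A. Z t \<omega>)\<^sup>2)"
    and "expectation (\<lambda>\<omega>. (\<Sum>t\<in>A. Z t \<omega>)\<^sup>2) \<le> card A * C"
proof -
  have sq: "(\<lambda>\<omega>. (\<Sum>t\<in>A. Z t \<omega>)\<^sup>2) = (\<lambda>\<omega>. \<Sum>s\<in>A. \<Sum>t\<in>A. Z s \<omega> * Z t \<omega>)"
    by (simp add: power2_eq_square sum_product)
  show "integrable M (\<lambda>\<omega>. (\<Sum>t\<in>A. Z t \<omega>)\<^sup>2)"
    unfolding sq using int by (intro Bochner_Integration.integrable_sum) auto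
  have "expectation (\<lambda>\<omega>. (\<Sum>t\<in>A. Z t \<omega>)\<^sup>2)
      = (\<Sum>s\<in>A. \<Sum>t\<in>A. expectation (\<lambda>\<omega>. Z s \<omega> * Z t \<omega>))"
    unfolding sq using int by (simp add: Bochner_Integration.integral_sum)
  also have "\<dots> \<le> (\<Sum>s\<in>A. C)"
  proof (rule sum_mono)
    fix s assume s: "s \<in> A"
    have "(\<Sum>t\<in>A. expectation (\<lambda>\<omega>. Z s \<omega> * Z t \<omega>))
        = (\<Sum>t\<in>A. if t = s then expectation (\<lambda>\<omega>. (Z s \<omega>)\<^sup>2) else 0)"
      using s orth by (intro sum.cong) (auto simp: power2_eq_square)
    also have "\<dots> \<le> C"
      using s bound[OF s] A by simp
    finally show "(\<Sum>t\<in>A. expectation (\<lambda>\<omega>. Z s \<omega> * Z t \<omega>)) \<le> C" .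
  qed
  finally show "expectation (\<lambda>\<omega>. (\<Sum>t\<in>A. Z t \<omega>)\<^sup>2) \<le> card A * C" by simp
qed

lemma expectation_mult_disjoint_coordinates:
  fixes f g :: "('i \<Rightarrow> real) \<Rightarrow> real"
  assumes ind: "indep_vars (\<lambda>_. borel) X I" and AB: "A \<inter> B = {}" "A \<subseteq> I" "B \<subseteq> I"
    and f[measurable]: "f \<in> borel_measurable (PiM A (\<lambda>_. borel))"
    and g[measurable]: "g \<in> borel_measurable (PiM B (\<lambda>_. borel))"
    and "integrable M (\<lambda>\<omega>. f (\<lambda>i\<in>A. X i \<omega>))" "integrable M (\<lambda>\<omega>. g (\<lambda>i\<in>B. X i \<omega>))"
  shows "expectation (\<lambda>\<omega>. f (\<lambda>i\<in>A. X i \<omega>) * g (\<lambda>i\<in>B. X i \<omega>))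
    = expectation (\<lambda>\<omega>. f (\<lambda>i\<in>A. X i \<omega>)) * expectation (\<lambda>\<omega>. g (\<lambda>i\<in>B. X i \<omega>))"
proof (rule indep_var_lebesgue_integral)
  show "indep_var borel (\<lambda>\<omega>. f (\<lambda>i\<in>A. X i \<omega>)) borel (\<lambda>\<omega>. g (\<lambda>i\<in>B. X i \<omega>))"
    using indep_var_compose[OF indep_var_restrict[OF ind AB] f g] by (simp add: comp_def)
qed fact+

lemma expectation_mult_indep_families:
  fixes f g :: "('i \<Rightarrow> real) \<Rightarrow> real"
  assumes ind: "indep_families X I Y J"
    and f: "f \<in> borel_measurable (PiM I (\<lambda>_. borel))"
    and g: "g \<in> borel_measurable (PiM J (\<lambda>_. borel))"
    and int: "integrable M (\<lambda>\<omega>. f (\<lambda>i\<in>I. X i \<omega>))" "integrable M (\<lambda>\<omega>. g (\<lambda>j\<in>J. Y j \<omega>))"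
  shows "integrable M (\<lambda>\<omega>. f (\<lambda>i\<in>I. X i \<omega>) * g (\<lambda>j\<in>J. Y j \<omega>))"
    and "expectation (\<lambda>\<omega>. f (\<lambda>i\<in>I. X i \<omega>) * g (\<lambda>j\<in>J. Y j \<omega>))
      = expectation (\<lambda>\<omega>. f (\<lambda>i\<in>I. X i \<omega>)) * expectation (\<lambda>\<omega>. g (\<lambda>j\<in>J. Y j \<omega>))"
proof -
  have "indep_var borel (\<lambda>\<omega>. f (\<lambda>i\<in>I. X i \<omega>)) borel (\<lambda>\<omega>. g (\<lambda>j\<in>J. Y j \<omega>))"
    using indep_var_compose[OF ind[unfolded indep_families_def] f g] by (simp add: comp_def)
  then show "integrable M (\<lambda>\<omega>. f (\<lambda>i\<in>I. X i \<omega>) * g (\<lambda>j\<in>J. Y j \<omega>))"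
    "expectation (\<lambda>\<omega>. f (\<lambda>i\<in>I. X i \<omega>) * g (\<lambda>j\<in>J. Y j \<omega>))
      = expectation (\<lambda>\<omega>. f (\<lambda>i\<in>I. X i \<omega>)) * expectation (\<lambda>\<omega>. g (\<lambda>j\<in>J. Y j \<omega>))"
    using int by (rule indep_var_integrable, rule indep_var_lebesgue_integral)
qed

lemma indep_families_rv:
  assumes "indep_families X I Y J" "i \<in> I"
  shows "random_variable borel (X i)"
proof -
  have "random_variable (PiM I (\<lambda>_. borel)) (\<lambda>\<omega>. \<lambda>i\<in>I. X i \<omega>)"
    using assms(1) unfolding indep_families_def by (rule indep_var_rv1)
  from measurable_compose[OF this measurable_component_singleton[OF assms(2)]]
  show ?thesis using assms(2) by simp
qed

lemma nonneg_Fatou: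
  fixes f :: "nat \<Rightarrow> 'a \<Rightarrow> real"
  assumes int: "\<And>k. integrable M (f k)" and nn: "\<And>k \<omega>. 0 \<le> f k \<omega>"
    and le: "\<And>k. expectation (f k) \<le> C" and F[measurable]: "random_variable borel F"
    and lim: "AE \<omega> in M. (\<lambda>k. f k \<omega>) \<longlonglongrightarrow> F \<omega>"
  shows "integrable M F" and "expectation F \<le> C"
proof -
  have [measurable]: "random_variable borel (f k)" for k using int[of k] by simp
  have C: "0 \<le> C" 
    using le[of 0] nn by (intro order_trans[OF integral_nonneg_AE[of "f 0" M]]) auto
  have F_nn: "AE \<omega> in M. 0 \<le> F \<omega>"
    using lim by eventually_elim (auto intro: LIMSEQ_le_const nn)
  have "(\<integral>\<^sup>+\<omega>. F \<omega> \<partial>M) = (\<integral>\<^sup>+\<omega>. liminf (\<lambda>k. ennreal (f k \<omega>)) \<partial>M)"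
  proof (rule nn_integral_cong_AE)
    show "AE \<omega> in M. ennreal (F \<omega>) = liminf (\<lambda>k. ennreal (f k \<omega>))"
      using lim
    proof eventually_elim
      case (elim \<omega>)
      then have "(\<lambda>k. ennreal (f k \<omega>)) \<longlonglongrightarrow> ennreal (F \<omega>)" by (rule tendsto_ennrealI)
      then show ?case by (intro lim_imp_Liminf[symmetric]) auto
    qed
  qed
  also have "\<dots> \<le> liminf (\<lambda>k. \<integral>\<^sup>+\<omega>. ennreal (f k \<omega>) \<partial>M)"
    by (rule nn_integral_liminf) simp
  also have "\<dots> \<le> liminf (\<lambda>k. ennreal C)"
    using int nn le by (intro Liminf_mono always_eventually allI)
      (auto simp: nn_integral_eq_integral intro!: ennreal_leI)
  also have "\<dots> = ennreal C" by (simp add: Liminf_const)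
  finally have nni: "(\<integral>\<^sup>+\<omega>. F \<omega> \<partial>M) \<le> ennreal C" .
  then show "integrable M F"
    using F_nn by (intro integrableI_nonneg) (auto intro: le_less_trans)
  then show "expectation F \<le> C"
    using nni F_nn C by (simp add: nn_integral_eq_integral)
qed

end

text \<open>
  The index set is a parameter because the innovations of the input are indexed by all integers,
  the measurement noise only by positive times.
\<close>

locale white_noise = prob_space M for M :: "'a measure" +
  fixes X :: "int \<Rightarrow> 'a \<Rightarrow> real" and I :: "int set" and s C :: real
  assumes indep: "indep_vars (\<lambda>_. borel) X I"
    and mean: "\<And>i. i \<in> I \<Longrightarrow> expectation (X i) = 0"
    and var: "\<And>i. i \<in> I \<Longrightarrow> expectation (\<lambda>\<omega>. (X i \<omega>)\<^sup>2) = s"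
    and int4: "\<And>i. i \<in> I \<Longrightarrow> integrable M (\<lambda>\<omega>. X i \<omega> ^ 4)"
    and moment4: "\<And>i. i \<in> I \<Longrightarrow> expectation (\<lambda>\<omega>. X i \<omega> ^ 4) \<le> C"
begin

lemma rv[measurable]: "i \<in> I \<Longrightarrow> random_variable borel (X i)"
  using indep by (simp add: indep_vars_def)

lemma integrable_X: "i \<in> I \<Longrightarrow> integrable M (X i)"
  and integrable_XX: "i \<in> I \<Longrightarrow> j \<in> I \<Longrightarrow> integrable M (\<lambda>\<omega>. X i \<omega> * X j \<omega>)"
  and integrable_XXX: "i \<in> I \<Longrightarrow> j \<in> I \<Longrightarrow> k \<in> I \<Longrightarrow>
    integrable M (\<lambda>\<omega>. X i \<omega> * X j \<omega> * X k \<omega>)"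
  and integrable_XXXX: "i \<in> I \<Longrightarrow> j \<in> I \<Longrightarrow> k \<in> I \<Longrightarrow> l \<in> I \<Longrightarrow>
    integrable M (\<lambda>\<omega>. X i \<omega> * X j \<omega> * X k \<omega> * X l \<omega>)"
  using integrable_mult4[of "X i" "\<lambda>_. 1" "\<lambda>_. 1" "\<lambda>_. 1"]
    integrable_mult4[of "X i" "X j" "\<lambda>_. 1" "\<lambda>_. 1"]
    integrable_mult4[of "X i" "X j" "X k" "\<lambda>_. 1"]
    integrable_mult4[of "X i" "X j" "X k" "X l"]
  by (simp_all add: rv int4)

lemma covariance_X:
  assumes "i \<in> I" "j \<in> I"
  shows "expectation (\<lambda>\<omega>. X i \<omega> * X j \<omega>) = (if i = j then s else 0)"
proof (cases "i = j")
  case False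
  have "expectation (\<lambda>\<omega>. X i \<omega> * X j \<omega>) = expectation (X i) * expectation (X j)"
    using expectation_mult_disjoint_coordinates[OF indep, of "{i}" "{j}" "\<lambda>x. x i" "\<lambda>x. x j"]
      False assms integrable_X by simp
  then show ?thesis using False assms by (simp add: mean)
qed (use assms in \<open>simp add: var flip: power2_eq_square\<close>)

lemma expectation_isolated_factor:
  assumes "{i, j, k, l} \<subseteq> I" "i \<notin> {j, k, l}"
  shows "expectation (\<lambda>\<omega>. X i \<omega> * (X j \<omega> * X k \<omega> * X l \<omega>)) = 0"
proof -
  have "expectation (\<lambda>\<omega>. X i \<omega> * (X j \<omega> * X k \<omega> * X l \<omega>))
      = expectation (X i) * expectation (\<lambda>\<omega>. X j \<omega> * X k \<omega> * X l \<omega>)"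
    using expectation_mult_disjoint_coordinates[OF indep, of "{i}" "{j, k, l}" "\<lambda>x. x i"
        "\<lambda>x. x j * x k * x l"] assms integrable_X integrable_XXX by simp
  then show ?thesis using assms by (simp add: mean)
qed

lemma expectation_squares:
  assumes "i \<in> I" "j \<in> I" "i \<noteq> j"
  shows "expectation (\<lambda>\<omega>. (X i \<omega>)\<^sup>2 * (X j \<omega>)\<^sup>2) = s * s"
  using expectation_mult_disjoint_coordinates[OF indep, of "{i}" "{j}" "\<lambda>x. (x i)\<^sup>2" "\<lambda>x. (x j)\<^sup>2"]
    assms integrable_XX[of i i] integrable_XX[of j j] by (simp add: var flip: power2_eq_square)

text \<open>The product of the values at lags \<open>a\<close> and \<open>b\<close>, centred at its expectation.\<close>

definition lagged_product :: "int \<Rightarrow> int \<Rightarrow> int \<Rightarrow> 'a \<Rightarrow> real" where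
  "lagged_product a b t \<omega> = X (t - a) \<omega> * X (t - b) \<omega> - (if a = b then s else 0)"

lemma integrable_lagged_product_mult:
  assumes "t - a \<in> I" "t - b \<in> I" "r - a \<in> I" "r - b \<in> I"
  shows "integrable M (\<lambda>\<omega>. lagged_product a b t \<omega> * lagged_product a b r \<omega>)"
proof -
  let ?c = "if a = b then s else 0"
  have "(\<lambda>\<omega>. lagged_product a b t \<omega> * lagged_product a b r \<omega>) =
    (\<lambda>\<omega>. X (t - a) \<omega> * X (t - b) \<omega> * X (r - a) \<omega> * X (r - b) \<omega>
      - ?c * (X (t - a) \<omega> * X (t - b) \<omega>) - ?c * (X (r - a) \<omega> * X (r - b) \<omega>) + ?c * ?c)"
    unfolding lagged_product_def by (rule ext) (simp only: algebra_simps)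
  moreover have "integrable M \<dots>"
    using integrable_XXXX[OF assms] integrable_XX[OF assms(1,2)] integrable_XX[OF assms(3,4)]
    by (intro Bochner_Integration.integrable_add Bochner_Integration.integrable_diff
        integrable_mult_right integrable_const)
  ultimately show ?thesis by (simp only:)
qed

text \<open>
  For \<open>a = b\<close> the factors are centred squares of independent variables. For \<open>a \<noteq> b\<close> the two
  coincidences \<open>t - a = r - b\<close> and \<open>t - b = r - a\<close> cannot hold together, as they would force
  \<open>a - b = b - a\<close>; hence one of \<open>t - a\<close>, \<open>t - b\<close> occurs only once among the four indices, and the
  independent centred variable at that index makes the expectation vanish.
\<close>

lemma lagged_product_orthogonal:
  assumes I: "t - a \<in> I" "t - b \<in> I" "r - a \<in> I" "r - b \<in> I" and "t \<noteq> r"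
  shows "expectation (\<lambda>\<omega>. lagged_product a b t \<omega> * lagged_product a b r \<omega>) = 0"
proof (cases "a = b")
  case True
  have "expectation (\<lambda>\<omega>. lagged_product a b t \<omega> * lagged_product a b r \<omega>)
      = expectation (\<lambda>\<omega>. (X (t - a) \<omega>)\<^sup>2 * (X (r - a) \<omega>)\<^sup>2 - s * (X (t - a) \<omega>)\<^sup>2
          - s * (X (r - a) \<omega>)\<^sup>2 + s * s)"
    unfolding lagged_product_def True
    by (rule Bochner_Integration.integral_cong) (simp_all add: algebra_simps power2_eq_square)
  also have "\<dots> = 0"
    using integrable_XXXX[OF I(1,1,3,3)] integrable_XX[OF I(1,1)] integrable_XX[OF I(3,3)]
      expectation_squares[OF I(1,3)] var[OF I(1)] var[OF I(3)] \<open>t \<noteq> r\<close>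
    by (simp add: power2_eq_square prob_space mult.assoc)
  finally show ?thesis .
next
  case False
  have prod_eq: "lagged_product a b t \<omega> * lagged_product a b r \<omega>
      = X (t - a) \<omega> * (X (t - b) \<omega> * X (r - a) \<omega> * X (r - b) \<omega>)"
    "lagged_product a b t \<omega> * lagged_product a b r \<omega>
      = X (t - b) \<omega> * (X (t - a) \<omega> * X (r - a) \<omega> * X (r - b) \<omega>)" for \<omega>
    using False by (simp_all add: lagged_product_def)
  have "t - a \<noteq> r - b \<or> t - b \<noteq> r - a" using False by linarith
  then show ?thesis
  proof
    assume "t - a \<noteq> r - b"
    then have "t - a \<notin> {t - b, r - a, r - b}" using False \<open>t \<noteq> r\<close> by simp
    then show ?thesis
      unfolding prod_eq(1) using I by (intro expectation_isolated_factor) simp_all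
  next
    assume "t - b \<noteq> r - a"
    then have "t - b \<notin> {t - a, r - a, r - b}" using False \<open>t \<noteq> r\<close> by simp
    then show ?thesis
      unfolding prod_eq(2) using I by (intro expectation_isolated_factor) simp_all
  qed
qed

lemma lagged_product_second_moment:
  assumes I: "t - a \<in> I" "t - b \<in> I"
  shows "expectation (\<lambda>\<omega>. (lagged_product a b t \<omega>)\<^sup>2) \<le> C"
proof -
  have int: "integrable M (\<lambda>\<omega>. (X (t - a) \<omega> * X (t - b) \<omega>)\<^sup>2)"
    using integrable_XXXX[OF I I] by (simp add: power2_eq_square mult_ac)
  have "expectation (\<lambda>\<omega>. (lagged_product a b t \<omega>)\<^sup>2)
      = expectation (\<lambda>\<omega>. (X (t - a) \<omega> * X (t - b) \<omega>)\<^sup>2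
        - 2 * (if a = b then s else 0) * (X (t - a) \<omega> * X (t - b) \<omega>) + (if a = b then s else 0)\<^sup>2)"
    unfolding lagged_product_def
    by (rule Bochner_Integration.integral_cong) (simp_all add: power2_eq_square algebra_simps)
  also have "\<dots> = expectation (\<lambda>\<omega>. (X (t - a) \<omega> * X (t - b) \<omega>)\<^sup>2) - (if a = b then s else 0)\<^sup>2"
    using int integrable_XX[OF I] covariance_X[OF I] by (simp add: prob_space power2_eq_square)
  also have "\<dots> \<le> expectation (\<lambda>\<omega>. (X (t - a) \<omega> * X (t - b) \<omega>)\<^sup>2)" by simp
  also have "\<dots> \<le> expectation (\<lambda>\<omega>. (X (t - a) \<omega> ^ 4 + X (t - b) \<omega> ^ 4) / 2)"
  proof (rule integral_mono[OF int])
    show "integrable M (\<lambda>\<omega>. (X (t - a) \<omega> ^ 4 + X (t - b) \<omega> ^ 4) / 2)"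
      using int4 I by simp
    show "(x * y)\<^sup>2 \<le> (x ^ 4 + y ^ 4) / 2" for x y :: real
      using zero_le_power2[of "x\<^sup>2 - y\<^sup>2"] by (simp add: power2_diff power_mult_distrib)
  qed
  also have "\<dots> \<le> C"
    using int4[OF I(1)] int4[OF I(2)] moment4[OF I(1)] moment4[OF I(2)] by simp
  finally show ?thesis .
qed

lemma lagged_product_sum:
  assumes "finite A" "\<And>t. t \<in> A \<Longrightarrow> t - a \<in> I" "\<And>t. t \<in> A \<Longrightarrow> t - b \<in> I"
  shows "integrable M (\<lambda>\<omega>. (\<Sum>t\<in>A. lagged_product a b t \<omega>)\<^sup>2)"
    and "expectation (\<lambda>\<omega>. (\<Sum>t\<in>A. lagged_product a b t \<omega>)\<^sup>2) \<le> card A * C"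
proof -
  note sum = second_moment_orthogonal_sum[OF assms(1), of "lagged_product a b" C]
  show "integrable M (\<lambda>\<omega>. (\<Sum>t\<in>A. lagged_product a b t \<omega>)\<^sup>2)"
    by (rule sum(1))
       (simp_all add: assms integrable_lagged_product_mult lagged_product_orthogonal
         lagged_product_second_moment)
  show "expectation (\<lambda>\<omega>. (\<Sum>t\<in>A. lagged_product a b t \<omega>)\<^sup>2) \<le> card A * C"
    by (rule sum(2))
       (simp_all add: assms integrable_lagged_product_mult lagged_product_orthogonal
         lagged_product_second_moment)
qed

end

section \<open>Sample autocovariances of linear processes\<close>

locale linear_process = white_noise M e UNIV s C for M :: "'a measure" and e s C +
  fixes h :: "nat \<Rightarrow> real" and u :: "int \<Rightarrow> 'a \<Rightarrow> real" and T :: "int set"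
  assumes h_summable: "summable (\<lambda>k. \<bar>h k\<bar>)"
    and u_rv[measurable]: "t \<in> T \<Longrightarrow> random_variable borel (u t)"
    and u_sums: "t \<in> T \<Longrightarrow> AE \<omega> in M. (\<lambda>k. h k * e (t - int k) \<omega>) sums u t \<omega>"
begin

definition truncation :: "nat \<Rightarrow> int \<Rightarrow> 'a \<Rightarrow> real" where
  "truncation K t \<omega> = (\<Sum>k<K. h k * e (t - int k) \<omega>)"

definition H :: real where "H = (\<Sum>k. \<bar>h k\<bar>)"

lemma H_nonneg: "0 \<le> H"
  unfolding H_def by (intro suminf_nonneg h_summable) simp

lemma sum_abs_h_le: "(\<Sum>k<K. \<bar>h k\<bar>) \<le> H"
  unfolding H_def by (intro sum_le_suminf h_summable) auto

lemma truncation_rv[measurable]: "random_variable borel (truncation K t)"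
  unfolding truncation_def by measurable

lemma truncation_tendsto: "t \<in> T \<Longrightarrow> AE \<omega> in M. (\<lambda>K. truncation K t \<omega>) \<longlonglongrightarrow> u t \<omega>"
  using u_sums by (simp add: truncation_def sums_def)

lemma s_nonneg: "0 \<le> s"
  using var[of 0] integral_nonneg_AE[of "\<lambda>\<omega>. (e 0 \<omega>)\<^sup>2" M] by simp

lemma C_nonneg: "0 \<le> C"
  using moment4[of 0] by (intro order_trans[OF integral_nonneg_AE[of "\<lambda>\<omega>. e 0 \<omega> ^ 4" M]]) auto

text \<open>
  The majorant needed for dominated convergence is \<open>H\<close> times the series of \<open>\<bar>h k\<bar> e(t - k)\<^sup>2\<close>. It is
  integrable by monotone convergence, and it dominates the squares of all truncations at once by the
  weighted Cauchy-Schwarz inequality.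
\<close>

lemma truncation_square_majorant:
  obtains B where "integrable M B" "AE \<omega> in M. \<forall>K. (truncation K t \<omega>)\<^sup>2 \<le> B \<omega>"
proof -
  define f where "f k \<omega> = \<bar>h k\<bar> * (e (t - int k) \<omega>)\<^sup>2" for k \<omega>
  have f_nn: "0 \<le> f k \<omega>" for k \<omega> by (simp add: f_def)
  have f_int: "integrable M (f k)" for k
    using integrable_XX[of "t - int k" "t - int k"] by (simp add: f_def[abs_def] power2_eq_square)
  have f_rv[measurable]: "random_variable borel (f k)" for k using f_int[of k] by simp
  have f_E: "expectation (f k) = \<bar>h k\<bar> * s" for k
    using var[of "t - int k"] by (simp add: f_def[abs_def])
  have summ: "summable (\<lambda>k. \<bar>h k\<bar> * s)" using h_summable by (rule summable_mult2)
  have "(\<integral>\<^sup>+\<omega>. (\<Sum>k. ennreal (f k \<omega>)) \<partial>M) = (\<Sum>k. \<integral>\<^sup>+\<omega>. ennreal (f k \<omega>) \<partial>M)"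
    by (rule nn_integral_suminf) simp
  also have "\<dots> = (\<Sum>k. ennreal (\<bar>h k\<bar> * s))"
    using f_int f_nn f_E by (simp add: nn_integral_eq_integral)
  also have "\<dots> \<noteq> \<infinity>"
    unfolding infinity_ennreal_def
    by (rule ennreal_suminf_neq_top[OF summ]) (simp add: s_nonneg)
  finally have "AE \<omega> in M. (\<Sum>k. ennreal (f k \<omega>)) \<noteq> \<infinity>"
    by (rule nn_integral_PInf_AE[rotated]) measurable
  then have f_summ: "AE \<omega> in M. summable (\<lambda>k. f k \<omega>)"
  proof eventually_elim
    case (elim \<omega>)
    then show ?case
      unfolding infinity_ennreal_def by (rule summable_suminf_not_top[OF f_nn])
  qed
  have int: "integrable M (\<lambda>\<omega>. \<Sum>k. f k \<omega>)"
  proof (rule integrable_suminf[OF f_int])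
    show "AE \<omega> in M. summable (\<lambda>k. norm (f k \<omega>))" using f_summ f_nn by simp
    show "summable (\<lambda>k. \<integral>\<omega>. norm (f k \<omega>) \<partial>M)" using summ f_nn f_E by simp
  qed
  have "AE \<omega> in M. \<forall>K. (truncation K t \<omega>)\<^sup>2 \<le> H * (\<Sum>k. f k \<omega>)"
    using f_summ
  proof (eventually_elim, intro allI)
    fix \<omega> K assume sm: "summable (\<lambda>k. f k \<omega>)"
    have "(truncation K t \<omega>)\<^sup>2 \<le> (\<Sum>k<K. \<bar>h k\<bar>) * (\<Sum>k<K. f k \<omega>)"
      unfolding truncation_def f_def by (rule weighted_Cauchy_Schwarz)
    also have "\<dots> \<le> H * (\<Sum>k. f k \<omega>)"
      using sum_abs_h_le sm f_nn H_nonneg by (intro mult_mono sum_le_suminf sum_nonneg) auto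
    finally show "(truncation K t \<omega>)\<^sup>2 \<le> H * (\<Sum>k. f k \<omega>)" .
  qed
  then show ?thesis using int that[of "\<lambda>\<omega>. H * (\<Sum>k. f k \<omega>)"] by simp
qed

text \<open>The covariance of the truncated process at lag \<open>d\<close>.\<close>

definition trunc_acov :: "nat \<Rightarrow> int \<Rightarrow> real" where
  "trunc_acov K d = (\<Sum>(k, l)\<in>{..<K} \<times> {..<K}. h k * h l * (if d = int k - int l then s else 0))"

lemma trunc_mult:
  "truncation K t \<omega> * truncation K r \<omega>
    = (\<Sum>(k, l)\<in>{..<K} \<times> {..<K}. h k * h l * (e (t - int k) \<omega> * e (r - int l) \<omega>))"
  unfolding truncation_def sum_product sum.cartesian_product by (simp add: mult_ac)

lemma expectation_trunc_mult:
  "expectation (\<lambda>\<omega>. truncation K t \<omega> * truncation K r \<omega>) = trunc_acov K (t - r)"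
proof -
  have "t - int k = r - int l \<longleftrightarrow> t - r = int k - int l" for k l by auto
  then show ?thesis
    unfolding trunc_mult trunc_acov_def
    by (subst Bochner_Integration.integral_sum)
       (auto intro!: sum.cong simp: integrable_XX covariance_X)
qed

lemma mean_u:
  assumes t: "t \<in> T"
  shows "expectation (u t) = 0"
proof -
  obtain B where B: "integrable M B" "AE \<omega> in M. \<forall>K. (truncation K t \<omega>)\<^sup>2 \<le> B \<omega>"
    by (rule truncation_square_majorant)
  have dom: "AE \<omega> in M. norm (truncation K t \<omega>) \<le> 1 + B \<omega>" for K
    using B(2)
  proof eventually_elim
    case (elim \<omega>)
    have "\<bar>x\<bar> \<le> 1 + x\<^sup>2" for x :: real
      using zero_le_power2[of "\<bar>x\<bar> - 1"] by (simp add: power2_diff)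
    then show ?case using elim by (metis add_le_cancel_left order_trans real_norm_def)
  qed
  note lim = integral_dominated_convergence[of "u t" M "\<lambda>K. truncation K t" "\<lambda>\<omega>. 1 + B \<omega>",
      OF u_rv[OF t] truncation_rv _ truncation_tendsto[OF t] dom]
  have int1B: "integrable M (\<lambda>\<omega>. 1 + B \<omega>)" using B(1) by simp
  have "expectation (truncation K t) = 0" for K
    unfolding truncation_def by (simp add: integrable_X mean)
  then show "expectation (u t) = 0"
    using lim[OF int1B] by (simp add: LIMSEQ_const_iff)
qed

lemma
  assumes t: "t \<in> T" and r: "r \<in> T"
  shows integrable_uu: "integrable M (\<lambda>\<omega>. u t \<omega> * u r \<omega>)"
    and trunc_acov_tendsto: "(\<lambda>K. trunc_acov K (t - r)) \<longlonglongrightarrow> expectation (\<lambda>\<omega>. u t \<omega> * u r \<omega>)"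
proof -
  obtain B where B: "integrable M B" "AE \<omega> in M. \<forall>K. (truncation K t \<omega>)\<^sup>2 \<le> B \<omega>"
    by (rule truncation_square_majorant)
  obtain B' where B': "integrable M B'" "AE \<omega> in M. \<forall>K. (truncation K r \<omega>)\<^sup>2 \<le> B' \<omega>"
    by (rule truncation_square_majorant)
  have dom: "AE \<omega> in M. norm (truncation K t \<omega> * truncation K r \<omega>) \<le> B \<omega> + B' \<omega>" for K
    using B(2) B'(2)
  proof eventually_elim
    case (elim \<omega>)
    have "\<bar>x * y\<bar> \<le> x\<^sup>2 + y\<^sup>2" for x y :: real
    proof -
      have "2 * \<bar>x * y\<bar> \<le> x\<^sup>2 + y\<^sup>2"
        using zero_le_power2[of "\<bar>x\<bar> - \<bar>y\<bar>"] by (simp add: power2_diff abs_mult)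
      then show ?thesis using abs_ge_zero[of "x * y"] by linarith
    qed
    then show ?case using elim by (metis add_mono order_trans real_norm_def)
  qed
  have lim: "AE \<omega> in M. (\<lambda>K. truncation K t \<omega> * truncation K r \<omega>) \<longlonglongrightarrow> u t \<omega> * u r \<omega>"
    using truncation_tendsto[OF t] truncation_tendsto[OF r]
    by eventually_elim (rule tendsto_mult)
  have [measurable]: "random_variable borel (\<lambda>\<omega>. u t \<omega> * u r \<omega>)"
    using t r by simp
  have int: "integrable M (\<lambda>\<omega>. B \<omega> + B' \<omega>)" using B(1) B'(1) by simp
  show "integrable M (\<lambda>\<omega>. u t \<omega> * u r \<omega>)"
    by (rule integrable_dominated_convergence[OF _ _ int lim dom]) simp_all
  show "(\<lambda>K. trunc_acov K (t - r)) \<longlonglongrightarrow> expectation (\<lambda>\<omega>. u t \<omega> * u r \<omega>)"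
    unfolding expectation_trunc_mult[symmetric]
    by (rule integral_dominated_convergence[OF _ _ int lim dom]) simp_all
qed

text \<open>
  Defined as a limit of the covariances of the truncations rather than as an expectation, so that
  the dependence on the lag alone, that is, stationarity, is built in.
\<close>

definition acov :: "int \<Rightarrow> real" where
  "acov d = lim (\<lambda>K. trunc_acov K d)"

lemma expectation_uu: "t \<in> T \<Longrightarrow> r \<in> T \<Longrightarrow> expectation (\<lambda>\<omega>. u t \<omega> * u r \<omega>) = acov (t - r)"
  unfolding acov_def using trunc_acov_tendsto by (rule limI[symmetric])

text \<open>
  The centred sample autocovariance of the truncated process is \<open>\<Sum>\<^bsub>(k, l)\<^esub> h(k) h(l) Z(k, l)\<close>, where
  \<open>Z(k, l)\<close> sums the lagged products of the innovations for the lags \<open>p + k\<close> and \<open>q + l\<close> over the sample.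
  Each \<open>Z(k, l)\<close> has second moment at most \<open>card A * C\<close>, and the weights contribute \<open>(H\<^sup>2)\<^sup>2\<close>. The bound is
  independent of \<open>K\<close>.
\<close>

lemma sample_autocov_truncated:
  assumes "finite A"
  shows "integrable M (\<lambda>\<omega>. (\<Sum>t\<in>A. truncation K (t - p) \<omega> * truncation K (t - q) \<omega>
      - trunc_acov K (q - p))\<^sup>2)" (is "integrable M ?S")
    and "expectation (\<lambda>\<omega>. (\<Sum>t\<in>A. truncation K (t - p) \<omega> * truncation K (t - q) \<omega>
      - trunc_acov K (q - p))\<^sup>2) \<le> H ^ 4 * (card A * C)"
proof -
  let ?K = "{..<K} \<times> {..<K}"
  define w :: "nat \<times> nat \<Rightarrow> real" where "w = (\<lambda>(k, l). h k * h l)"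
  define Z where "Z = (\<lambda>(k, l) \<omega>. \<Sum>t\<in>A. lagged_product (p + int k) (q + int l) t \<omega>)"
  have Z_int: "integrable M (\<lambda>\<omega>. (Z kl \<omega>)\<^sup>2)" for kl
    by (cases kl) (simp add: Z_def lagged_product_sum[OF assms])
  have Z_le: "expectation (\<lambda>\<omega>. (Z kl \<omega>)\<^sup>2) \<le> card A * C" for kl
    by (cases kl) (simp add: Z_def lagged_product_sum[OF assms])
  have Z_rv[measurable]: "random_variable borel (Z kl)" for kl
    by (cases kl) (simp add: Z_def lagged_product_def)
  have sum_w: "(\<Sum>kl\<in>?K. \<bar>w kl\<bar>) \<le> H\<^sup>2"
  proof -
    have "(\<Sum>kl\<in>?K. \<bar>w kl\<bar>) = (\<Sum>k<K. \<bar>h k\<bar>) * (\<Sum>k<K. \<bar>h k\<bar>)"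
      by (simp add: w_def sum_product sum.cartesian_product abs_mult split_beta)
    also have "\<dots> \<le> H * H"
      using sum_abs_h_le H_nonneg by (intro mult_mono sum_nonneg) auto
    finally show ?thesis by (simp add: power2_eq_square)
  qed
  have eq: "(\<Sum>t\<in>A. truncation K (t - p) \<omega> * truncation K (t - q) \<omega> - trunc_acov K (q - p))
      = (\<Sum>kl\<in>?K. w kl * Z kl \<omega>)" for \<omega>
  proof -
    have if_eq: "(q - p = int k - int l) = (p + int k = q + int l)" for k l by auto
    have "truncation K (t - p) \<omega> * truncation K (t - q) \<omega> - trunc_acov K (q - p)
        = (\<Sum>(k, l)\<in>?K. h k * h l * lagged_product (p + int k) (q + int l) t \<omega>)" for t
      unfolding trunc_mult trunc_acov_def sum_subtractf[symmetric]
      by (intro sum.cong refl)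
         (auto simp: lagged_product_def right_diff_distrib diff_diff_eq if_eq)
    then have "(\<Sum>t\<in>A. truncation K (t - p) \<omega> * truncation K (t - q) \<omega> - trunc_acov K (q - p))
        = (\<Sum>t\<in>A. \<Sum>(k, l)\<in>?K. h k * h l * lagged_product (p + int k) (q + int l) t \<omega>)"
      by simp
    also have "\<dots> = (\<Sum>(k, l)\<in>?K. \<Sum>t\<in>A. h k * h l * lagged_product (p + int k) (q + int l) t \<omega>)"
      by (simp add: split_beta sum.swap[of _ A])
    finally show ?thesis
      by (simp add: w_def Z_def split_beta sum_distrib_left)
  qed
  have le: "(\<Sum>kl\<in>?K. w kl * Z kl \<omega>)\<^sup>2 \<le> H\<^sup>2 * (\<Sum>kl\<in>?K. \<bar>w kl\<bar> * (Z kl \<omega>)\<^sup>2)" for \<omega>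
    by (rule order_trans[OF weighted_Cauchy_Schwarz])
       (intro mult_right_mono sum_w sum_nonneg, simp)
  have int: "integrable M (\<lambda>\<omega>. H\<^sup>2 * (\<Sum>kl\<in>?K. \<bar>w kl\<bar> * (Z kl \<omega>)\<^sup>2))"
    using Z_int by simp
  have int': "integrable M (\<lambda>\<omega>. (\<Sum>kl\<in>?K. w kl * Z kl \<omega>)\<^sup>2)"
    by (rule Bochner_Integration.integrable_bound[OF int])
       (use le in \<open>auto intro!: AE_I2 intro: order_trans[OF _ abs_ge_self]\<close>)
  then show "integrable M ?S" unfolding eq .
  have "expectation ?S \<le> expectation (\<lambda>\<omega>. H\<^sup>2 * (\<Sum>kl\<in>?K. \<bar>w kl\<bar> * (Z kl \<omega>)\<^sup>2))"
    unfolding eq using int' int le by (rule integral_mono)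
  also have "\<dots> = H\<^sup>2 * (\<Sum>kl\<in>?K. \<bar>w kl\<bar> * expectation (\<lambda>\<omega>. (Z kl \<omega>)\<^sup>2))"
    using Z_int by simp
  also have "\<dots> \<le> H\<^sup>2 * (\<Sum>kl\<in>?K. \<bar>w kl\<bar> * (card A * C))"
    using Z_le by (intro mult_left_mono sum_mono) auto
  also have "\<dots> = H\<^sup>2 * ((\<Sum>kl\<in>?K. \<bar>w kl\<bar>) * (card A * C))"
    by (simp add: sum_distrib_right)
  also have "\<dots> \<le> H\<^sup>2 * (H\<^sup>2 * (card A * C))"
    using sum_w C_nonneg by (intro mult_left_mono mult_right_mono) auto
  finally show "expectation ?S \<le> H ^ 4 * (card A * C)"
    by (simp add: power4_eq_xxxx power2_eq_square mult_ac)
qed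

lemma sample_autocov:
  assumes A: "finite A" and T: "\<And>t. t \<in> A \<Longrightarrow> t - p \<in> T" "\<And>t. t \<in> A \<Longrightarrow> t - q \<in> T"
  shows "integrable M (\<lambda>\<omega>. (\<Sum>t\<in>A. u (t - p) \<omega> * u (t - q) \<omega> - acov (q - p))\<^sup>2)"
    and "expectation (\<lambda>\<omega>. (\<Sum>t\<in>A. u (t - p) \<omega> * u (t - q) \<omega> - acov (q - p))\<^sup>2)
      \<le> H ^ 4 * (card A * C)"
proof -
  let ?S = "\<lambda>K \<omega>. (\<Sum>t\<in>A. truncation K (t - p) \<omega> * truncation K (t - q) \<omega> - trunc_acov K (q - p))\<^sup>2"
  let ?F = "\<lambda>\<omega>. (\<Sum>t\<in>A. u (t - p) \<omega> * u (t - q) \<omega> - acov (q - p))\<^sup>2"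
  have [measurable]: "random_variable borel (u (t - p))" "random_variable borel (u (t - q))"
    if "t \<in> A" for t
    using T[OF that] by (simp_all add: u_rv)
  have rv: "random_variable borel ?F"
    by measurable
  have acov_lim: "(\<lambda>K. trunc_acov K (q - p)) \<longlonglongrightarrow> acov (q - p)" if "t \<in> A" for t
    using trunc_acov_tendsto[OF T[OF that]] expectation_uu[OF T[OF that]] by simp
  have "AE \<omega> in M. \<forall>t\<in>A. (\<lambda>K. truncation K (t - p) \<omega>) \<longlonglongrightarrow> u (t - p) \<omega>"
    "AE \<omega> in M. \<forall>t\<in>A. (\<lambda>K. truncation K (t - q) \<omega>) \<longlonglongrightarrow> u (t - q) \<omega>"
    using A T truncation_tendsto by (auto simp: AE_finite_all)
  then have lim: "AE \<omega> in M. (\<lambda>K. ?S K \<omega>) \<longlonglongrightarrow> ?F \<omega>"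
  proof eventually_elim
    case (elim \<omega>)
    show ?case
    proof (rule tendsto_power, rule tendsto_sum, rule tendsto_diff)
      fix t assume t: "t \<in> A"
      show "(\<lambda>K. truncation K (t - p) \<omega> * truncation K (t - q) \<omega>) \<longlonglongrightarrow> u (t - p) \<omega> * u (t - q) \<omega>"
        using elim t by (intro tendsto_mult) auto
      show "(\<lambda>K. trunc_acov K (q - p)) \<longlonglongrightarrow> acov (q - p)" using t by (rule acov_lim)
    qed
  qed
  note Fatou = nonneg_Fatou[of ?S, OF sample_autocov_truncated(1)[OF A] zero_le_power2
      sample_autocov_truncated(2)[OF A] rv lim]
  show "integrable M ?F" by (rule Fatou(1))
  show "expectation ?F \<le> H ^ 4 * (card A * C)" by (rule Fatou(2))
qed

end

text \<open>
  Independence of \<open>u\<close> and \<open>v\<close> factorises the mixed fourth moment into a covariance of \<open>u\<close> and one of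
  \<open>v\<close>, and the latter vanishes off the diagonal. So the summands are uncorrelated even though the
  \<open>u(t)\<close> are not.
\<close>

lemma (in linear_process) cross_moment_sum:
  assumes v: "white_noise M v J w D" and ind: "indep_families u T v J"
    and A: "finite A" "\<And>t. t \<in> A \<Longrightarrow> t - p \<in> T" "\<And>t. t \<in> A \<Longrightarrow> t \<in> J"
  shows "integrable M (\<lambda>\<omega>. (\<Sum>t\<in>A. u (t - p) \<omega> * v t \<omega>)\<^sup>2)"
    and "expectation (\<lambda>\<omega>. (\<Sum>t\<in>A. u (t - p) \<omega> * v t \<omega>)\<^sup>2) \<le> card A * (acov 0 * w)"
proof -
  interpret v: white_noise M v J w D by (rule v)
  let ?Z = "\<lambda>t \<omega>. u (t - p) \<omega> * v t \<omega>"
  have ZZ: "integrable M (\<lambda>\<omega>. ?Z t \<omega> * ?Z r \<omega>)"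
    "expectation (\<lambda>\<omega>. ?Z t \<omega> * ?Z r \<omega>) = acov (t - r) * (if t = r then w else 0)"
    if t: "t \<in> A" and r: "r \<in> A" for t r
  proof -
    have eq: "(\<lambda>\<omega>. ?Z t \<omega> * ?Z r \<omega>) = (\<lambda>\<omega>. (u (t - p) \<omega> * u (r - p) \<omega>) * (v t \<omega> * v r \<omega>))"
      by (simp add: mult_ac)
    note T = A(2)[OF t] A(2)[OF r] and J = A(3)[OF t] A(3)[OF r]
    note mult = expectation_mult_indep_families[OF ind, of "\<lambda>x. x (t - p) * x (r - p)" "\<lambda>y. y t * y r"]
    have meas: "(\<lambda>x. x (t - p) * x (r - p)) \<in> borel_measurable (PiM T (\<lambda>_. borel :: real measure))"
      "(\<lambda>y. y t * y r) \<in> borel_measurable (PiM J (\<lambda>_. borel :: real measure))"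
      using T J by measurable
    show "integrable M (\<lambda>\<omega>. ?Z t \<omega> * ?Z r \<omega>)"
      unfolding eq using mult(1)[OF meas] T J integrable_uu[OF T] v.integrable_XX[OF J] by simp
    show "expectation (\<lambda>\<omega>. ?Z t \<omega> * ?Z r \<omega>) = acov (t - r) * (if t = r then w else 0)"
      unfolding eq using mult(2)[OF meas] T J integrable_uu[OF T] v.integrable_XX[OF J]
        expectation_uu[OF T] v.covariance_X[OF J] by simp
  qed
  note sum = second_moment_orthogonal_sum[OF A(1), of ?Z "acov 0 * w"]
  show "integrable M (\<lambda>\<omega>. (\<Sum>t\<in>A. ?Z t \<omega>)\<^sup>2)"
    by (rule sum(1)) (simp_all only: ZZ, simp_all add: power2_eq_square ZZ)
  show "expectation (\<lambda>\<omega>. (\<Sum>t\<in>A. ?Z t \<omega>)\<^sup>2) \<le> card A * (acov 0 * w)"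
    by (rule sum(2)) (simp_all only: ZZ, simp_all add: power2_eq_square ZZ)
qed

section \<open>Matrix norms and inverses\<close>

lemma vec_norm_nonneg: "0 \<le> vec_norm x"
  by (simp add: vec_norm_def L2_set_nonneg)

lemma frobenius_norm_nonneg: "0 \<le> frobenius_norm A"
  by (simp add: frobenius_norm_def L2_set_nonneg)

lemma vec_norm_le_sum: "vec_norm x \<le> (\<Sum>i<dim_vec x. \<bar>x $ i\<bar>)"
  unfolding vec_norm_def by (rule L2_set_le_sum_abs)

lemma frobenius_norm_le_sum:
  "frobenius_norm A \<le> (\<Sum>ij\<in>{..<dim_row A} \<times> {..<dim_col A}. \<bar>A $$ ij\<bar>)"
  unfolding frobenius_norm_def by (rule L2_set_le_sum_abs)

lemma vec_norm_smult: "vec_norm (c \<cdot>\<^sub>v x) = \<bar>c\<bar> * vec_norm x"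
  unfolding vec_norm_def L2_set_def
  by (simp add: power_mult_distrib real_sqrt_mult flip: sum_distrib_left)

lemma frobenius_norm_smult: "frobenius_norm (c \<cdot>\<^sub>m A) = \<bar>c\<bar> * frobenius_norm A"
proof -
  have "(\<Sum>ij\<in>{..<dim_row A} \<times> {..<dim_col A}. ((c \<cdot>\<^sub>m A) $$ ij)\<^sup>2)
      = c\<^sup>2 * (\<Sum>ij\<in>{..<dim_row A} \<times> {..<dim_col A}. (A $$ ij)\<^sup>2)"
    unfolding sum_distrib_left by (intro sum.cong) (auto simp: power_mult_distrib)
  then show ?thesis by (simp add: frobenius_norm_def L2_set_def real_sqrt_mult)
qed

lemma vec_norm_square: "(vec_norm x)\<^sup>2 = x \<bullet> x"
  by (simp add: vec_norm_def L2_set_def scalar_prod_def sum_nonneg power2_eq_square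
      flip: lessThan_atLeast0)

lemma vec_norm_triangle:
  assumes "x \<in> carrier_vec n" "y \<in> carrier_vec n"
  shows "vec_norm (x + y) \<le> vec_norm x + vec_norm y"
proof -
  have "vec_norm (x + y) = L2_set (\<lambda>i. x $ i + y $ i) {..<n}"
    using assms by (simp add: vec_norm_def L2_set_def)
  also have "\<dots> \<le> L2_set (\<lambda>i. x $ i) {..<n} + L2_set (\<lambda>i. y $ i) {..<n}"
    by (rule L2_set_triangle_ineq)
  finally show ?thesis using assms by (simp add: vec_norm_def)
qed

lemma scalar_prod_Cauchy_Schwarz:
  assumes "x \<in> carrier_vec n" "y \<in> carrier_vec n"
  shows "\<bar>x \<bullet> y\<bar> \<le> vec_norm x * vec_norm y"
proof -
  have "\<bar>x \<bullet> y\<bar> \<le> (\<Sum>i<n. \<bar>x $ i\<bar> * \<bar>y $ i\<bar>)"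
    using assms by (simp add: scalar_prod_def lessThan_atLeast0 flip: abs_mult)
  also have "\<dots> \<le> vec_norm x * vec_norm y"
    using L2_set_mult_ineq[of "\<lambda>i. x $ i" "\<lambda>i. y $ i" "{..<n}"] assms by (simp add: vec_norm_def)
  finally show ?thesis .
qed

lemma vec_norm_mult_mat_vec_le:
  assumes A: "A \<in> carrier_mat r c" and x: "x \<in> carrier_vec c"
  shows "vec_norm (A *\<^sub>v x) \<le> frobenius_norm A * vec_norm x"
proof -
  have row: "((A *\<^sub>v x) $ i)\<^sup>2 \<le> (\<Sum>j<c. (A $$ (i, j))\<^sup>2) * (vec_norm x)\<^sup>2" if "i < r" for i
  proof -
    have "((A *\<^sub>v x) $ i)\<^sup>2 = (\<Sum>j<c. A $$ (i, j) * x $ j)\<^sup>2"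
      using that A x by (simp add: scalar_prod_def lessThan_atLeast0)
    also have "\<dots> \<le> (\<Sum>j<c. (A $$ (i, j))\<^sup>2) * (\<Sum>j<c. (x $ j)\<^sup>2)"
      by (rule Cauchy_Schwarz_ineq_sum)
    also have "(\<Sum>j<c. (x $ j)\<^sup>2) = (vec_norm x)\<^sup>2"
      using x by (simp add: vec_norm_def L2_set_def sum_nonneg)
    finally show ?thesis .
  qed
  have "(vec_norm (A *\<^sub>v x))\<^sup>2 = (\<Sum>i<r. ((A *\<^sub>v x) $ i)\<^sup>2)"
    using A by (simp add: vec_norm_def L2_set_def sum_nonneg)
  also have "\<dots> \<le> (\<Sum>i<r. (\<Sum>j<c. (A $$ (i, j))\<^sup>2) * (vec_norm x)\<^sup>2)"
    using row by (intro sum_mono) simp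
  also have "\<dots> = (frobenius_norm A * vec_norm x)\<^sup>2"
    using A by (simp add: frobenius_norm_def L2_set_def sum_nonneg power_mult_distrib
        sum.cartesian_product flip: sum_distrib_right)
  finally show ?thesis
    by (rule power2_le_imp_le) (simp add: vec_norm_nonneg frobenius_norm_nonneg)
qed

text \<open>
  From \<open>d = B (S d) = B (G d) - B ((G - S) d)\<close>, the last term has norm at most \<open>\<parallel>d\<parallel> / 2\<close> and is absorbed
  on the left. In particular \<open>G\<close> has trivial kernel.
\<close>

lemma near_invertible_bound:
  assumes B: "B \<in> carrier_mat n n" and S: "S \<in> carrier_mat n n" and G: "G \<in> carrier_mat n n"
    and inv: "B * S = 1\<^sub>m n" and small: "frobenius_norm B * frobenius_norm (G - S) \<le> 1 / 2"
    and d: "d \<in> carrier_vec n"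
  shows "vec_norm d \<le> 2 * frobenius_norm B * vec_norm (G *\<^sub>v d)"
proof -
  let ?D = "G - S"
  have D: "?D \<in> carrier_mat n n" using S by (rule minus_carrier_mat)
  have Gd: "G *\<^sub>v d \<in> carrier_vec n" and Dd: "?D *\<^sub>v d \<in> carrier_vec n"
    using G D d by auto
  have "S *\<^sub>v d = G *\<^sub>v d - ?D *\<^sub>v d"
    using G S d by (auto simp: minus_mult_distrib_mat_vec)
  then have Sd: "S *\<^sub>v d = G *\<^sub>v d + (-1) \<cdot>\<^sub>v (?D *\<^sub>v d)"
    using Gd Dd by auto
  have "d = B *\<^sub>v (S *\<^sub>v d)"
    using inv B S d by (simp flip: assoc_mult_mat_vec)
  then have "vec_norm d \<le> frobenius_norm B * vec_norm (S *\<^sub>v d)"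
    using vec_norm_mult_mat_vec_le[OF B, of "S *\<^sub>v d"] S d by simp
  also have "\<dots> \<le> frobenius_norm B * (vec_norm (G *\<^sub>v d) + vec_norm (?D *\<^sub>v d))"
    unfolding Sd using vec_norm_triangle[OF Gd, of "(-1) \<cdot>\<^sub>v (?D *\<^sub>v d)"] Dd
    by (intro mult_left_mono) (simp_all add: vec_norm_smult frobenius_norm_nonneg)
  also have "\<dots> \<le> frobenius_norm B * (vec_norm (G *\<^sub>v d) + frobenius_norm ?D * vec_norm d)"
    using vec_norm_mult_mat_vec_le[OF D d]
    by (intro mult_left_mono add_left_mono) (simp_all add: frobenius_norm_nonneg)
  also have "\<dots> \<le> frobenius_norm B * vec_norm (G *\<^sub>v d) + 1 / 2 * vec_norm d"
    using mult_right_mono[OF small vec_norm_nonneg[of d]] by (simp add: algebra_simps)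
  finally show ?thesis by simp
qed

lemma pos_def_left_inverse:
  assumes "pos_def n S"
  obtains B where "B \<in> carrier_mat n n" "B * S = 1\<^sub>m n"
proof -
  have S: "S \<in> carrier_mat n n" using assms by (simp add: pos_def_def)
  have "Determinant.det S \<noteq> 0"
  proof
    assume "Determinant.det S = 0"
    then obtain x where x: "x \<in> carrier_vec n" "x \<noteq> 0\<^sub>v n" "S *\<^sub>v x = 0\<^sub>v n"
      using det_0_iff_vec_prod_zero[OF S] by blast
    then have "0 < x \<bullet> (S *\<^sub>v x)" using assms unfolding pos_def_def by blast
    then show False using x by simp
  qed
  moreover have "(1 / Determinant.det S) \<cdot>\<^sub>m adj_mat S * S
      = (1 / Determinant.det S) \<cdot>\<^sub>m (Determinant.det S \<cdot>\<^sub>m 1\<^sub>m n)"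
    unfolding adj_mat(3)[OF S, symmetric] using adj_mat(1)[OF S] S by (rule mult_smult_assoc_mat)
  ultimately have "(1 / Determinant.det S) \<cdot>\<^sub>m adj_mat S * S = 1\<^sub>m n"
    by (auto intro!: eq_matI)
  then show ?thesis using that[of "(1 / Determinant.det S) \<cdot>\<^sub>m adj_mat S"] adj_mat(1)[OF S] by simp
qed

lemma mat_inv_right_inverse:
  assumes A: "A \<in> carrier_mat n n" and det: "Determinant.det A \<noteq> 0"
  shows "mat_inv A \<in> carrier_mat n n" "A * mat_inv A = 1\<^sub>m n"
proof -
  obtain B where B: "mat_inverse A = Some B"
    using mat_inverse(1)[OF A, where b = "()"] det_non_zero_imp_unit[OF A det, where b = "()"]
    by (cases "mat_inverse A") auto
  then show "mat_inv A \<in> carrier_mat n n" "A * mat_inv A = 1\<^sub>m n"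
    using mat_inverse(2)[OF A B] by (simp_all add: mat_inv_def)
qed

text \<open>
  For singular \<open>A\<close> both sides are zero, the right one because of \<open>1 / 0 = 0\<close>. The formula makes the
  entries of the inverse rational functions of the entries of \<open>A\<close>, hence measurable.
\<close>

lemma mat_inv_eq_adj_mat:
  assumes A: "A \<in> carrier_mat n n"
  shows "mat_inv A = (1 / Determinant.det A) \<cdot>\<^sub>m adj_mat A"
proof (cases "Determinant.det A = 0")
  case True
  have "mat_inverse A = None"
  proof (rule ccontr)
    assume "mat_inverse A \<noteq> None"
    then obtain B where "mat_inverse A = Some B" by auto
    then have B: "A * B = 1\<^sub>m n" "B \<in> carrier_mat n n" using mat_inverse(2)[OF A] by auto
    then have "Determinant.det A * Determinant.det B = 1"
      using A by (metis det_mult det_one)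
    then show False using True by simp
  qed
  then show ?thesis using True A adj_mat(1)[OF A] by (auto simp: mat_inv_def)
next
  case False
  note inv = mat_inv_right_inverse[OF A False]
  have adj: "adj_mat A \<in> carrier_mat n n" by (rule adj_mat(1)[OF A])
  have "Determinant.det A \<cdot>\<^sub>m mat_inv A = (adj_mat A * A) * mat_inv A"
    using inv(1) by (simp add: adj_mat(3)[OF A] mult_smult_assoc_mat[of _ n n _ n])
  also have "\<dots> = adj_mat A"
    using inv adj A by simp
  finally have "adj_mat A = Determinant.det A \<cdot>\<^sub>m mat_inv A" by (rule sym)
  then show ?thesis using False inv(1) by (auto intro!: eq_matI)
qed

section \<open>Random vectors and matrices\<close>

definition random_mat :: "'a measure \<Rightarrow> nat \<Rightarrow> nat \<Rightarrow> ('a \<Rightarrow> real mat) \<Rightarrow> bool" where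
  "random_mat M r c A \<longleftrightarrow> (\<forall>\<omega>. A \<omega> \<in> carrier_mat r c) \<and>
    (\<forall>i<r. \<forall>j<c. (\<lambda>\<omega>. A \<omega> $$ (i, j)) \<in> borel_measurable M)"

definition random_vec :: "'a measure \<Rightarrow> nat \<Rightarrow> ('a \<Rightarrow> real vec) \<Rightarrow> bool" where
  "random_vec M n x \<longleftrightarrow> (\<forall>\<omega>. x \<omega> \<in> carrier_vec n) \<and>
    (\<forall>i<n. (\<lambda>\<omega>. x \<omega> $ i) \<in> borel_measurable M)"

lemma random_matD:
  assumes "random_mat M r c A"
  shows "A \<omega> \<in> carrier_mat r c" "dim_row (A \<omega>) = r" "dim_col (A \<omega>) = c"
    and "i < r \<Longrightarrow> j < c \<Longrightarrow> (\<lambda>\<omega>. A \<omega> $$ (i, j)) \<in> borel_measurable M"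
  using assms by (auto simp: random_mat_def)

lemma random_vecD:
  assumes "random_vec M n x"
  shows "x \<omega> \<in> carrier_vec n" "dim_vec (x \<omega>) = n"
    and "i < n \<Longrightarrow> (\<lambda>\<omega>. x \<omega> $ i) \<in> borel_measurable M"
  using assms by (auto simp: random_vec_def)

lemma random_mat_const: "A \<in> carrier_mat r c \<Longrightarrow> random_mat M r c (\<lambda>_. A)"
  by (simp add: random_mat_def)

lemma random_vec_const: "x \<in> carrier_vec n \<Longrightarrow> random_vec M n (\<lambda>_. x)"
  by (simp add: random_vec_def)

lemma random_mat_transpose:
  assumes A: "random_mat M r c A"
  shows "random_mat M c r (\<lambda>\<omega>. (A \<omega>)\<^sup>T)"
  using random_matD[OF A] by (simp add: random_mat_def)

lemma random_mat_smult:
  assumes A: "random_mat M r c A" and "k \<in> borel_measurable M"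
  shows "random_mat M r c (\<lambda>\<omega>. k \<omega> \<cdot>\<^sub>m A \<omega>)"
  using random_matD[OF A] assms(2) by (simp add: random_mat_def)

lemma random_mat_minus:
  assumes A: "random_mat M r c A" and B: "random_mat M r c B"
  shows "random_mat M r c (\<lambda>\<omega>. A \<omega> - B \<omega>)"
  using random_matD[OF A] random_matD[OF B] by (simp add: random_mat_def minus_carrier_mat)

lemma random_mat_mult:
  assumes A: "random_mat M r k A" and B: "random_mat M k c B"
  shows "random_mat M r c (\<lambda>\<omega>. A \<omega> * B \<omega>)"
  using random_matD[OF A] random_matD[OF B]
  by (auto simp: random_mat_def scalar_prod_def intro!: mult_carrier_mat)

lemma random_vec_mult_mat_vec:
  assumes A: "random_mat M r c A" and x: "random_vec M c x"
  shows "random_vec M r (\<lambda>\<omega>. A \<omega> *\<^sub>v x \<omega>)"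
  using random_matD(4)[OF A] random_vecD(3)[OF x] random_matD(1)[OF A] random_vecD(1)[OF x]
  by (auto simp: random_vec_def scalar_prod_def random_matD(2,3)[OF A] random_vecD(2)[OF x]
      intro!: mult_mat_vec_carrier)

lemma random_vec_plus:
  assumes x: "random_vec M n x" and y: "random_vec M n y"
  shows "random_vec M n (\<lambda>\<omega>. x \<omega> + y \<omega>)"
  using random_vecD(3)[OF x] random_vecD(3)[OF y]
  by (simp add: random_vec_def random_vecD(1,2)[OF x] random_vecD(1,2)[OF y])

lemma random_vec_minus:
  assumes x: "random_vec M n x" and y: "random_vec M n y"
  shows "random_vec M n (\<lambda>\<omega>. x \<omega> - y \<omega>)"
  using random_vecD(3)[OF x] random_vecD(3)[OF y]
  by (simp add: random_vec_def random_vecD(1,2)[OF x] random_vecD(1,2)[OF y])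

lemma random_vec_smult:
  assumes x: "random_vec M n x" and "k \<in> borel_measurable M"
  shows "random_vec M n (\<lambda>\<omega>. k \<omega> \<cdot>\<^sub>v x \<omega>)"
  using random_vecD(3)[OF x] assms(2)
  by (simp add: random_vec_def random_vecD(1,2)[OF x])

lemma borel_measurable_scalar_prod:
  assumes x: "random_vec M n x" and y: "random_vec M n y"
  shows "(\<lambda>\<omega>. x \<omega> \<bullet> y \<omega>) \<in> borel_measurable M"
  using random_vecD(3)[OF x] random_vecD(3)[OF y]
  by (simp add: scalar_prod_def random_vecD(2)[OF y])

lemma borel_measurable_vec_norm:
  assumes x: "random_vec M n x"
  shows "(\<lambda>\<omega>. vec_norm (x \<omega>)) \<in> borel_measurable M"
  using random_vecD(3)[OF x] by (simp add: vec_norm_def L2_set_def random_vecD(2)[OF x])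

lemma borel_measurable_frobenius_norm:
  assumes A: "random_mat M r c A"
  shows "(\<lambda>\<omega>. frobenius_norm (A \<omega>)) \<in> borel_measurable M"
proof -
  have "(\<lambda>\<omega>. A \<omega> $$ ij) \<in> borel_measurable M" if "ij \<in> {..<r} \<times> {..<c}" for ij
    using that random_matD(4)[OF A] by auto
  then show ?thesis using random_matD[OF A] by (simp add: frobenius_norm_def L2_set_def)
qed

lemma borel_measurable_det:
  assumes A: "random_mat M n n A"
  shows "(\<lambda>\<omega>. Determinant.det (A \<omega>)) \<in> borel_measurable M"
proof -
  have "(\<lambda>\<omega>. A \<omega> $$ (i, p i)) \<in> borel_measurable M"
    if "p permutes {0..<n}" "i \<in> {0..<n}" for p i
    using random_matD(4)[OF A] that permutes_in_image[OF that(1), of i] by simp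
  then show ?thesis
    unfolding det_def'[OF random_matD(1)[OF A]] by simp
qed

lemma random_mat_mat_delete:
  assumes A: "random_mat M n n A" and "i < n" "j < n"
  shows "random_mat M (n - 1) (n - 1) (\<lambda>\<omega>. mat_delete (A \<omega>) i j)"
  using random_matD[OF A] assms(2,3) by (auto simp: random_mat_def mat_delete_def)

lemma random_mat_mat_inv:
  assumes A: "random_mat M n n A"
  shows "random_mat M n n (\<lambda>\<omega>. mat_inv (A \<omega>))"
proof -
  have "random_mat M n n (\<lambda>\<omega>. adj_mat (A \<omega>))"
    unfolding random_mat_def
  proof (intro conjI allI impI)
    show "adj_mat (A \<omega>) \<in> carrier_mat n n" for \<omega> by (rule adj_mat(1)[OF random_matD(1)[OF A]])
    fix i j assume "i < n" "j < n"
    then show "(\<lambda>\<omega>. adj_mat (A \<omega>) $$ (i, j)) \<in> borel_measurable M"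
      using random_matD[OF A] borel_measurable_det[OF random_mat_mat_delete[OF A]]
      by (simp add: adj_mat_def Determinant.cofactor_def)
  qed
  then show ?thesis
    unfolding mat_inv_eq_adj_mat[OF random_matD(1)[OF A]]
    using borel_measurable_det[OF A] by (intro random_mat_smult) auto
qed

context prob_space
begin

lemma Op_vec_componentsI:
  assumes S: "S \<noteq> {}" and \<xi>: "\<And>N. N \<in> S \<Longrightarrow> random_vec M n (\<xi> N)"
    and a: "\<And>N. N \<in> S \<Longrightarrow> a N \<noteq> 0"
    and comp: "\<And>i. i < n \<Longrightarrow> Op_real S (\<lambda>N \<omega>. \<xi> N \<omega> $ i) a"
  shows "Op_vec S \<xi> a"
proof -
  have "bounded_in_prob S (\<lambda>N \<omega>. vec_norm ((1 / a N) \<cdot>\<^sub>v \<xi> N \<omega>))"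
  proof (rule bounded_in_prob_mono[OF S])
    show "random_variable borel (\<lambda>\<omega>. vec_norm ((1 / a N) \<cdot>\<^sub>v \<xi> N \<omega>))" if "N \<in> S" for N
      using \<xi>[OF that] by (intro borel_measurable_vec_norm random_vec_smult) auto
    show "bounded_in_prob S (\<lambda>N \<omega>. \<Sum>i<n. \<bar>\<xi> N \<omega> $ i / a N\<bar>)"
      using comp by (intro bounded_in_prob_sum S) (auto simp: Op_real_def)
    show "vec_norm ((1 / a N) \<cdot>\<^sub>v \<xi> N \<omega>) \<le> (\<Sum>i<n. \<bar>\<xi> N \<omega> $ i / a N\<bar>)" if "N \<in> S" for N \<omega>
      using vec_norm_le_sum[of "(1 / a N) \<cdot>\<^sub>v \<xi> N \<omega>"] random_vecD(2)[OF \<xi>[OF that]] by simp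
  qed
  then show ?thesis using a by (simp add: Op_vec_def)
qed

lemma Op_mat_componentsI:
  assumes S: "S \<noteq> {}" and \<xi>: "\<And>N. N \<in> S \<Longrightarrow> random_mat M r c (\<xi> N)"
    and a: "\<And>N. N \<in> S \<Longrightarrow> a N \<noteq> 0"
    and comp: "\<And>i j. i < r \<Longrightarrow> j < c \<Longrightarrow> Op_real S (\<lambda>N \<omega>. \<xi> N \<omega> $$ (i, j)) a"
  shows "Op_mat S \<xi> a"
proof -
  have "bounded_in_prob S (\<lambda>N \<omega>. frobenius_norm ((1 / a N) \<cdot>\<^sub>m \<xi> N \<omega>))"
  proof (rule bounded_in_prob_mono[OF S])
    show "random_variable borel (\<lambda>\<omega>. frobenius_norm ((1 / a N) \<cdot>\<^sub>m \<xi> N \<omega>))" if "N \<in> S" for N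
      using \<xi>[OF that] by (intro borel_measurable_frobenius_norm random_mat_smult) auto
    show "bounded_in_prob S (\<lambda>N \<omega>. \<Sum>ij\<in>{..<r} \<times> {..<c}. \<bar>\<xi> N \<omega> $$ ij / a N\<bar>)"
      using comp by (intro bounded_in_prob_sum S) (auto simp: Op_real_def)
    fix N \<omega> assume N: "N \<in> S"
    have "frobenius_norm ((1 / a N) \<cdot>\<^sub>m \<xi> N \<omega>)
        \<le> (\<Sum>ij\<in>{..<r} \<times> {..<c}. \<bar>((1 / a N) \<cdot>\<^sub>m \<xi> N \<omega>) $$ ij\<bar>)"
      using frobenius_norm_le_sum[of "(1 / a N) \<cdot>\<^sub>m \<xi> N \<omega>"] by (simp add: random_matD(2,3)[OF \<xi>[OF N]])
    also have "\<dots> = (\<Sum>ij\<in>{..<r} \<times> {..<c}. \<bar>\<xi> N \<omega> $$ ij / a N\<bar>)"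
      by (intro sum.cong refl) (auto simp: random_matD(2,3)[OF \<xi>[OF N]])
    finally show "frobenius_norm ((1 / a N) \<cdot>\<^sub>m \<xi> N \<omega>) \<le> (\<Sum>ij\<in>{..<r} \<times> {..<c}. \<bar>\<xi> N \<omega> $$ ij / a N\<bar>)" .
  qed
  then show ?thesis using a by (simp add: Op_mat_def)
qed

lemma Op_real_cong:
  assumes "\<And>N \<omega>. N \<in> S \<Longrightarrow> \<xi> N \<omega> = \<eta> N \<omega>"
  shows "Op_real S \<xi> a \<longleftrightarrow> Op_real S \<eta> a"
  using assms by (simp add: Op_real_def bounded_in_prob_def cong: ball_cong SUP_cong)

lemma Op_real_mean:
  assumes S: "S \<noteq> {}" "\<And>N. N \<in> S \<Longrightarrow> 0 < N"
    and X: "\<And>N. N \<in> S \<Longrightarrow> random_variable borel (X N)"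
    and int: "\<And>N. N \<in> S \<Longrightarrow> integrable M (\<lambda>\<omega>. (X N \<omega>)\<^sup>2)"
    and bound: "\<And>N. N \<in> S \<Longrightarrow> expectation (\<lambda>\<omega>. (X N \<omega>)\<^sup>2) \<le> real N * C"
  shows "Op_real S (\<lambda>N \<omega>. X N \<omega> / N) (\<lambda>N. 1 / sqrt N)"
proof -
  have "bounded_in_prob S (\<lambda>N \<omega>. \<bar>X N \<omega> / sqrt N\<bar>)"
  proof (rule bounded_in_prob_second_moment[OF S(1), where C = C])
    fix N assume N: "N \<in> S"
    show "random_variable borel (\<lambda>\<omega>. X N \<omega> / sqrt N)" using X[OF N] by simp
    show "integrable M (\<lambda>\<omega>. (X N \<omega> / sqrt N)\<^sup>2)" using int[OF N] by (simp add: power_divide)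
    show "expectation (\<lambda>\<omega>. (X N \<omega> / sqrt N)\<^sup>2) \<le> C"
      using bound[OF N] S(2)[OF N] by (simp add: power_divide field_simps)
  qed
  then have "bounded_in_prob S (\<lambda>N \<omega>. \<bar>X N \<omega> / N / (1 / sqrt N)\<bar>)"
  proof (rule bounded_in_prob_mono[OF S(1), rotated])
    fix N \<omega> assume N: "N \<in> S"
    show "random_variable borel (\<lambda>\<omega>. \<bar>X N \<omega> / N / (1 / sqrt N)\<bar>)" using X[OF N] by simp
    have "x / N / (1 / sqrt N) = x / sqrt N" for x
      using S(2)[OF N] by (simp add: field_simps)
    then show "\<bar>X N \<omega> / N / (1 / sqrt N)\<bar> \<le> \<bar>X N \<omega> / sqrt N\<bar>" by (simp only: order_refl)
  qed
  then show ?thesis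
    using S(2) by (auto simp: Op_real_def)
qed

text \<open>A sum whose mean converges at rate \<open>1/\<surd>N\<close> grows at most like \<open>N\<close>; here \<open>1/\<surd>N \<le> 1\<close> is used.\<close>

lemma Op_real_uncenter:
  assumes S: "S \<noteq> {}" "\<And>N. N \<in> S \<Longrightarrow> 0 < N"
    and X: "\<And>N. N \<in> S \<Longrightarrow> random_variable borel (X N)"
    and Op: "Op_real S (\<lambda>N \<omega>. X N \<omega> / N - m) (\<lambda>N. 1 / sqrt N)"
  shows "Op_real S X (\<lambda>N. real N)"
proof -
  have "bounded_in_prob S (\<lambda>N \<omega>. \<bar>X N \<omega> / N\<bar>)"
  proof (rule bounded_in_prob_mono[OF S(1)])
    show "random_variable borel (\<lambda>\<omega>. \<bar>X N \<omega> / N\<bar>)" if "N \<in> S" for N using X[OF that] by simp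
    show "bounded_in_prob S (\<lambda>N \<omega>. \<bar>(X N \<omega> / N - m) / (1 / sqrt N)\<bar> + \<bar>m\<bar>)"
      using Op by (intro bounded_in_prob_add bounded_in_prob_const S(1)) (simp add: Op_real_def)
    fix N \<omega> assume "N \<in> S"
    then have "1 \<le> sqrt N" using S(2) by (simp add: Suc_leI)
    then have "\<bar>X N \<omega> / N - m\<bar> \<le> sqrt N * \<bar>X N \<omega> / N - m\<bar>"
      using mult_right_mono[of 1 "sqrt N" "\<bar>X N \<omega> / N - m\<bar>"] by simp
    then show "\<bar>X N \<omega> / N\<bar> \<le> \<bar>(X N \<omega> / N - m) / (1 / sqrt N)\<bar> + \<bar>m\<bar>"
      by (simp add: abs_mult mult.commute)
  qed
  then show ?thesis using S(2) by (auto simp: Op_real_def)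
qed

end

section \<open>The least squares estimator\<close>

lemma ls_estimator_carrier:
  assumes P: "P \<in> carrier_mat N n" and Y: "Y \<in> carrier_vec N"
  shows "ls_estimator P Y \<in> carrier_vec n"
proof -
  have G: "P\<^sup>T * P \<in> carrier_mat n n" using P by simp
  have "mat_inv (P\<^sup>T * P) \<in> carrier_mat n n"
    unfolding mat_inv_eq_adj_mat[OF G] using adj_mat(1)[OF G] by simp
  then show ?thesis using P Y unfolding ls_estimator_def
    by (intro mult_mat_vec_carrier[of _ n N] mult_carrier_mat[of _ n n]) auto
qed

lemma random_vec_ls_estimator:
  assumes P: "random_mat M N n P" and Y: "random_vec M N Y"
  shows "random_vec M n (\<lambda>\<omega>. ls_estimator (P \<omega>) (Y \<omega>))"
  unfolding ls_estimator_def
  by (rule random_vec_mult_mat_vec[OF random_mat_mult[OF random_mat_mat_inv[OF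
          random_mat_mult[OF random_mat_transpose[OF P] P]] random_mat_transpose[OF P]] Y])

text \<open>The normal equations, with \<open>P\<^sup>T P \<theta>\<close> subtracted from both sides.\<close>

lemma ls_estimator_error_equation:
  assumes P: "P \<in> carrier_mat N n" and \<theta>: "\<theta> \<in> carrier_vec n" and V: "V \<in> carrier_vec N"
    and det: "Determinant.det (P\<^sup>T * P) \<noteq> 0"
  shows "(P\<^sup>T * P) *\<^sub>v (ls_estimator P (P *\<^sub>v \<theta> + V) - \<theta>) = P\<^sup>T *\<^sub>v V"
proof -
  let ?G = "P\<^sup>T * P" and ?Y = "P *\<^sub>v \<theta> + V"
  have G: "?G \<in> carrier_mat n n" and PT: "P\<^sup>T \<in> carrier_mat n N" using P by auto
  have Y: "?Y \<in> carrier_vec N" using P \<theta> V by auto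
  note inv = mat_inv_right_inverse[OF G det]
  have est: "ls_estimator P ?Y \<in> carrier_vec n"
    unfolding ls_estimator_def using inv(1) PT Y by auto
  have "?G *\<^sub>v ls_estimator P ?Y = (?G * (mat_inv ?G * P\<^sup>T)) *\<^sub>v ?Y"
    unfolding ls_estimator_def using G inv(1) PT Y by (intro assoc_mult_mat_vec[symmetric]) auto
  also have "?G * (mat_inv ?G * P\<^sup>T) = P\<^sup>T"
    using assoc_mult_mat[OF G inv(1) PT] inv(2) PT by simp
  also have "P\<^sup>T *\<^sub>v ?Y = ?G *\<^sub>v \<theta> + P\<^sup>T *\<^sub>v V"
    using P \<theta> V PT by (simp add: mult_add_distrib_mat_vec assoc_mult_mat_vec)
  finally have "?G *\<^sub>v ls_estimator P ?Y = ?G *\<^sub>v \<theta> + P\<^sup>T *\<^sub>v V" .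
  then show ?thesis
    using mult_minus_distrib_mat_vec[OF G est \<theta>] G \<theta> PT V by auto
qed

text \<open>
  The residual is \<open>V - P (t - \<theta>)\<close>. Expanding its square for an arbitrary \<open>t\<close> expresses it through
  the error \<open>t - \<theta>\<close>, \<open>V\<^sup>T V\<close>, \<open>P\<^sup>T V\<close> and the Gram matrix, each of which has a rate of its own.
\<close>

lemma residual_square:
  assumes P: "P \<in> carrier_mat N n" and \<theta>: "\<theta> \<in> carrier_vec n" and t: "t \<in> carrier_vec n"
    and V: "V \<in> carrier_vec N"
  shows "(vec_norm (P *\<^sub>v \<theta> + V - P *\<^sub>v t))\<^sup>2
    = V \<bullet> V - 2 * ((t - \<theta>) \<bullet> (P\<^sup>T *\<^sub>v V)) + (t - \<theta>) \<bullet> ((P\<^sup>T * P) *\<^sub>v (t - \<theta>))"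
proof -
  define d where "d = t - \<theta>"
  have d: "d \<in> carrier_vec n" and Pd: "P *\<^sub>v d \<in> carrier_vec N" using \<theta> t P by (auto simp: d_def)
  have eq: "P *\<^sub>v \<theta> + V - P *\<^sub>v t = V - P *\<^sub>v d"
    unfolding d_def mult_minus_distrib_mat_vec[OF P t \<theta>] using P V \<theta> t by auto
  have adj: "d \<bullet> (P\<^sup>T *\<^sub>v x) = (P *\<^sub>v d) \<bullet> x" if "x \<in> carrier_vec N" for x
    using transpose_vec_mult_scalar[OF P d that]
    by (metis P d that comm_scalar_prod mult_mat_vec_carrier transpose_carrier_mat)
  have "(V - P *\<^sub>v d) \<bullet> (V - P *\<^sub>v d) = V \<bullet> V - 2 * ((P *\<^sub>v d) \<bullet> V) + (P *\<^sub>v d) \<bullet> (P *\<^sub>v d)"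
    using V Pd comm_scalar_prod[OF V Pd]
    by (simp add: minus_scalar_prod_distrib[of _ N] scalar_prod_minus_distrib[of _ N])
  moreover have "(P\<^sup>T * P) *\<^sub>v d = P\<^sup>T *\<^sub>v (P *\<^sub>v d)"
    using P d by (intro assoc_mult_mat_vec) auto
  ultimately show ?thesis
    unfolding eq vec_norm_square d_def[symmetric] using adj[OF V] adj[OF Pd] by simp
qed

text \<open>
  The smallness assumption serves twice: it makes \<open>P\<^sup>T P\<close> invertible, so that the normal equations
  hold, and it bounds their solution. Below, \<open>k\<close> is \<open>1 / N\<close> and \<open>S\<close> the limit covariance matrix.
\<close>

lemma ls_estimator_error_bound:
  assumes P: "P \<in> carrier_mat N n" and \<theta>: "\<theta> \<in> carrier_vec n" and V: "V \<in> carrier_vec N"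
    and B: "B \<in> carrier_mat n n" and S: "S \<in> carrier_mat n n" and inv: "B * S = 1\<^sub>m n"
    and k: "k \<noteq> 0"
    and small: "frobenius_norm B * frobenius_norm (k \<cdot>\<^sub>m (P\<^sup>T * P) - S) \<le> 1 / 2"
  shows "vec_norm (ls_estimator P (P *\<^sub>v \<theta> + V) - \<theta>)
    \<le> 2 * frobenius_norm B * vec_norm (k \<cdot>\<^sub>v (P\<^sup>T *\<^sub>v V))"
proof -
  let ?G = "P\<^sup>T * P"
  let ?d = "ls_estimator P (P *\<^sub>v \<theta> + V) - \<theta>"
  have G: "?G \<in> carrier_mat n n" and kG: "k \<cdot>\<^sub>m ?G \<in> carrier_mat n n" using P by auto
  have kGx: "(k \<cdot>\<^sub>m ?G) *\<^sub>v x = k \<cdot>\<^sub>v (?G *\<^sub>v x)" if "x \<in> carrier_vec n" for x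
    using G that by (intro eq_vecI) (auto simp: row_smult smult_scalar_prod_distrib[of _ n])
  note bound = near_invertible_bound[OF B S kG inv small]
  have "Determinant.det ?G \<noteq> 0"
  proof
    assume "Determinant.det ?G = 0"
    then obtain x where x: "x \<in> carrier_vec n" "x \<noteq> 0\<^sub>v n" "?G *\<^sub>v x = 0\<^sub>v n"
      using det_0_iff_vec_prod_zero[OF G] by blast
    have "vec_norm x \<le> 0"
      using bound[OF x(1)] unfolding kGx[OF x(1)] x(3) by (simp add: vec_norm_smult) (simp add: vec_norm_def L2_set_def)
    then have "x \<bullet> x = 0"
      using vec_norm_nonneg[of x] vec_norm_square[of x] by simp
    then show False using x conjugate_square_eq_0_vec[of x n] by simp
  qed
  note eq = ls_estimator_error_equation[OF P \<theta> V this]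
  have "?d \<in> carrier_vec n"
    using ls_estimator_carrier[OF P, of "P *\<^sub>v \<theta> + V"] P \<theta> V by simp
  then show ?thesis
    using bound[of ?d] kGx[of ?d] eq by simp
qed

text \<open>
  With \<open>q = N / (N - n)\<close>, the error of the estimator is \<open>q\<close> times the error of the residual mean square
  plus \<open>w n / (N - n)\<close>. The constants come from \<open>q \<le> n + 1\<close>, valid for all \<open>N > n\<close>, and from
  \<open>\<surd>N \<le> N\<close>; factors \<open>\<surd>N \<ge> 1\<close> are inserted so that only the normalised quantities \<open>\<surd>N \<parallel>d\<parallel>\<close> and
  \<open>\<surd>N \<parallel>P\<^sup>T V / N\<parallel>\<close> appear.
\<close>

lemma noise_var_estimator_error_bound:
  assumes P: "P \<in> carrier_mat N n" and \<theta>: "\<theta> \<in> carrier_vec n" and V: "V \<in> carrier_vec N"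
    and N: "n < N" and w: "0 \<le> w"
    and Y: "Y = P *\<^sub>v \<theta> + V" and d: "d = ls_estimator P Y - \<theta>"
  shows "sqrt N * \<bar>noise_var_estimator P Y - w\<bar> \<le>
    real (n + 1) * (sqrt N * \<bar>V \<bullet> V / N - w\<bar>
      + 2 * ((sqrt N * vec_norm d) * (sqrt N * vec_norm ((1 / N) \<cdot>\<^sub>v (P\<^sup>T *\<^sub>v V))))
      + (sqrt N * vec_norm d) * (sqrt N * vec_norm d) * frobenius_norm ((1 / N) \<cdot>\<^sub>m (P\<^sup>T * P)))
    + w * n * real (n + 1)"
proof -
  let ?W = "P\<^sup>T *\<^sub>v V" and ?G = "P\<^sup>T * P"
  define a where "a = d \<bullet> ?W"
  define b where "b = d \<bullet> (?G *\<^sub>v d)"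
  define q where "q = real N / (real N - real n)"
  define D where "D = sqrt N * vec_norm d"
  define W where "W = sqrt N * vec_norm ((1 / N) \<cdot>\<^sub>v ?W)"
  define F where "F = frobenius_norm ((1 / N) \<cdot>\<^sub>m ?G)"
  have N0: "1 \<le> sqrt N" "0 < real N" "0 < real N - real n" using N by auto
  have sqN: "sqrt N * sqrt N = real N" by simp
  have Yc: "Y \<in> carrier_vec N" using P \<theta> V Y by auto
  have t: "ls_estimator P Y \<in> carrier_vec n" by (rule ls_estimator_carrier[OF P Yc])
  have dc: "d \<in> carrier_vec n" using t \<theta> d by simp
  have Wc: "?W \<in> carrier_vec n" and Gc: "?G \<in> carrier_mat n n" using P V by auto
  have Gdc: "?G *\<^sub>v d \<in> carrier_vec n" using Gc dc by simp
  have DWF: "0 \<le> D" "0 \<le> W" "0 \<le> F"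
    by (simp_all add: D_def W_def F_def vec_norm_nonneg frobenius_norm_nonneg)
  have est: "noise_var_estimator P Y = (V \<bullet> V - 2 * a + b) / (real N - real n)"
    using residual_square[OF P \<theta> t V] P unfolding noise_var_estimator_def a_def b_def d Y by simp
  have a: "sqrt N * \<bar>a / N\<bar> \<le> D * W"
  proof -
    have "sqrt N * \<bar>a / N\<bar> \<le> sqrt N * (vec_norm d * vec_norm ?W / N)"
      unfolding a_def abs_divide using scalar_prod_Cauchy_Schwarz[OF dc Wc] N0
      by (intro mult_left_mono) (auto intro: divide_right_mono)
    also have "\<dots> = D * (vec_norm ?W / N)" by (simp add: D_def)
    also have "\<dots> \<le> D * W"
      using mult_right_mono[OF N0(1), of "vec_norm ?W / N"] DWF(1)
      by (intro mult_left_mono) (simp_all add: W_def vec_norm_smult vec_norm_nonneg)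
    finally show ?thesis .
  qed
  have b: "sqrt N * \<bar>b / N\<bar> \<le> D * D * F"
  proof -
    have "\<bar>b\<bar> \<le> vec_norm d * (frobenius_norm ?G * vec_norm d)"
      unfolding b_def
      by (rule order_trans[OF scalar_prod_Cauchy_Schwarz[OF dc Gdc]])
         (intro mult_left_mono vec_norm_mult_mat_vec_le[OF Gc dc] vec_norm_nonneg)
    then have "\<bar>b / N\<bar> \<le> vec_norm d * vec_norm d * F"
      using N0(2) by (simp add: F_def frobenius_norm_smult divide_right_mono mult_ac)
    then have "sqrt N * \<bar>b / N\<bar> \<le> sqrt N * (vec_norm d * vec_norm d * F)"
      by (intro mult_left_mono) auto
    also have "\<dots> \<le> real N * (vec_norm d * vec_norm d * F)"
      using N0(1) sqN DWF(3) mult_left_mono[OF N0(1), of "sqrt N"]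
      by (intro mult_right_mono) (auto simp: vec_norm_nonneg)
    also have "\<dots> = (sqrt N * sqrt N) * (vec_norm d * vec_norm d * F)" by (simp only: sqN)
    also have "\<dots> = D * D * F" by (simp only: D_def mult_ac)
    finally show ?thesis .
  qed
  have q: "0 \<le> q" "q \<le> n + 1" "sqrt N * (n / (real N - real n)) \<le> n * (n + 1)"
  proof -
    show "0 \<le> q" using N0 by (simp add: q_def)
    have "real n * (real n + 1) \<le> real n * real N" using N by (intro mult_left_mono) auto
    then show q_le: "q \<le> n + 1" using N0 by (simp add: q_def field_simps)
    have "sqrt N * (n / (real N - real n)) \<le> N * (n / (real N - real n))"
      using N0 sqN mult_left_mono[OF N0(1), of "sqrt N"] by (intro mult_right_mono) auto
    also have "\<dots> = n * q" by (simp add: q_def)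
    also have "\<dots> \<le> n * (n + 1)" using mult_left_mono[OF q_le, of "real n"] by (simp add: algebra_simps)
    finally show "sqrt N * (n / (real N - real n)) \<le> n * (n + 1)" by simp
  qed
  have "noise_var_estimator P Y - w
      = q * ((V \<bullet> V / N - w) - 2 * (a / N) + b / N) + w * (n / (real N - real n))"
  proof -
    define x where "x = V \<bullet> V"
    define m where "m = real N - real n"
    have m: "0 < m" "real N = m + n" using N0 by (auto simp: m_def)
    have "q * ((x / N - w) - 2 * (a / N) + b / N) = (x - w * N - 2 * a + b) / m"
      using N0(2) unfolding q_def m_def[symmetric] times_divide_eq_left
      by (intro arg_cong[of _ _ "\<lambda>y. y / m"]) (simp add: algebra_simps)
    also have "\<dots> + w * (n / m) = (x - 2 * a + b) / m - w"
      using m(1) unfolding m(2) by (simp add: field_simps)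
    finally show ?thesis unfolding est by (simp add: x_def m_def)
  qed
  also have "\<bar>\<dots>\<bar> \<le> \<bar>q * ((V \<bullet> V / N - w) - 2 * (a / N) + b / N)\<bar> + \<bar>w * (n / (real N - real n))\<bar>"
    by (rule abs_triangle_ineq)
  also have "\<dots> = q * \<bar>(V \<bullet> V / N - w) - 2 * (a / N) + b / N\<bar> + w * (n / (real N - real n))"
    using q(1) w N0 by (simp add: abs_mult)
  also have "\<dots> \<le> q * (\<bar>V \<bullet> V / N - w\<bar> + 2 * \<bar>a / N\<bar> + \<bar>b / N\<bar>) + w * (n / (real N - real n))"
    using q(1) by (intro add_mono mult_left_mono order_refl) linarith+
  finally have "sqrt N * \<bar>noise_var_estimator P Y - w\<bar>
      \<le> sqrt N * (q * (\<bar>V \<bullet> V / N - w\<bar> + 2 * \<bar>a / N\<bar> + \<bar>b / N\<bar>) + w * (n / (real N - real n)))"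
    by (intro mult_left_mono) auto
  also have "\<dots> = q * (sqrt N * \<bar>V \<bullet> V / N - w\<bar> + 2 * (sqrt N * \<bar>a / N\<bar>) + sqrt N * \<bar>b / N\<bar>)
      + w * (sqrt N * (n / (real N - real n)))"
    by (simp add: algebra_simps)
  also have "\<dots> \<le> (n + 1) * (sqrt N * \<bar>V \<bullet> V / N - w\<bar> + 2 * (D * W) + D * D * F) + w * (n * (n + 1))"
  proof (rule add_mono)
    show "q * (sqrt N * \<bar>V \<bullet> V / N - w\<bar> + 2 * (sqrt N * \<bar>a / N\<bar>) + sqrt N * \<bar>b / N\<bar>)
        \<le> (n + 1) * (sqrt N * \<bar>V \<bullet> V / N - w\<bar> + 2 * (D * W) + D * D * F)"
    proof (rule mult_mono)
      show "sqrt N * \<bar>V \<bullet> V / N - w\<bar> + 2 * (sqrt N * \<bar>a / N\<bar>) + sqrt N * \<bar>b / N\<bar>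
          \<le> sqrt N * \<bar>V \<bullet> V / N - w\<bar> + 2 * (D * W) + D * D * F"
        using a b by linarith
    qed (use q in simp_all)
    show "w * (sqrt N * (n / (real N - real n))) \<le> w * (n * (n + 1))"
      using q(3) w by (rule mult_left_mono)
  qed
  also have "\<dots> = (n + 1) * (sqrt N * \<bar>V \<bullet> V / N - w\<bar> + 2 * (D * W) + D * D * F) + w * n * (n + 1)"
    by (simp add: algebra_simps)
  finally show ?thesis by (simp only: D_def W_def F_def of_nat_add of_nat_1)
qed

lemma regressor_mat_carrier: "regressor_mat n u N \<omega> \<in> carrier_mat N n"
  unfolding regressor_mat_def
  using mat_of_rows_carrier(1)[of n "map (\<lambda>t. regressor n u t \<omega>) [1..<N+1]"]
  by (simp del: upt_Suc)

lemma regressor_mat_index: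
  "k < N \<Longrightarrow> i < n \<Longrightarrow> regressor_mat n u N \<omega> $$ (k, i) = u (int (k + 1) - int (i + 1)) \<omega>"
  by (simp add: regressor_mat_def regressor_def mat_of_rows_def del: upt_Suc)

lemma noise_vec_carrier: "noise_vec v N \<omega> \<in> carrier_vec N"
  by (simp add: noise_vec_def)

lemma sum_sample_times: "(\<Sum>k<N. f (int (k + 1))) = (\<Sum>t\<in>{1..int N}. f t)"
  by (rule sum.reindex_bij_witness[of _ "\<lambda>t. nat t - 1" "\<lambda>k. int (k + 1)"]) auto

lemma gram_index:
  assumes "i < n" "j < n"
  shows "((regressor_mat n u N \<omega>)\<^sup>T * regressor_mat n u N \<omega>) $$ (i, j)
    = (\<Sum>t\<in>{1..int N}. u (t - int (i + 1)) \<omega> * u (t - int (j + 1)) \<omega>)"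
  unfolding sum_sample_times[symmetric]
  using assms regressor_mat_carrier[of n u N \<omega>]
  by (simp add: scalar_prod_def lessThan_atLeast0 regressor_mat_index del: of_nat_Suc of_nat_add)

lemma cross_index:
  assumes "i < n"
  shows "((regressor_mat n u N \<omega>)\<^sup>T *\<^sub>v noise_vec v N \<omega>) $ i
    = (\<Sum>t\<in>{1..int N}. u (t - int (i + 1)) \<omega> * v t \<omega>)"
  unfolding sum_sample_times[symmetric]
  using assms regressor_mat_carrier[of n u N \<omega>]
  by (simp add: scalar_prod_def lessThan_atLeast0 regressor_mat_index noise_vec_def del: of_nat_Suc of_nat_add)

lemma noise_square: "noise_vec v N \<omega> \<bullet> noise_vec v N \<omega> = (\<Sum>t\<in>{1..int N}. v t \<omega> * v t \<omega>)"
  unfolding sum_sample_times[symmetric]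
  by (simp add: scalar_prod_def lessThan_atLeast0 noise_vec_def del: of_nat_Suc of_nat_add)

section \<open>Convergence rates\<close>

theorem theorem3:
  fixes M :: "'a measure"
    and n :: nat
    and u e v :: "int \<Rightarrow> 'a \<Rightarrow> real"
    and h :: "nat \<Rightarrow> real"
    and c \<sigma>\<^sub>e \<sigma> :: real
    and \<theta>\<^sub>0 :: "real vec"
    and \<Sigma> :: "real mat"
    and \<Phi> :: "nat \<Rightarrow> 'a \<Rightarrow> real mat"
    and V Y \<theta>LS :: "nat \<Rightarrow> 'a \<Rightarrow> real vec"
    and \<sigma>2hat :: "nat \<Rightarrow> 'a \<Rightarrow> real"
  assumes M: "prob_space M"
    and n: "1 \<le> n"
    and theta0: "\<theta>\<^sub>0 \<in> carrier_vec n"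
    and Phi: "\<Phi> = regressor_mat n u"
    and V: "V = noise_vec v"
    and Y: "Y = (\<lambda>N \<omega>. \<Phi> N \<omega> *\<^sub>v \<theta>\<^sub>0 + V N \<omega>)"
    and theta_LS: "\<theta>LS = (\<lambda>N \<omega>. ls_estimator (\<Phi> N \<omega>) (Y N \<omega>))"
    and sigma2_hat: "\<sigma>2hat = (\<lambda>N \<omega>. noise_var_estimator (\<Phi> N \<omega>) (Y N \<omega>))"
    and full_rank: "\<And>N. n < N \<Longrightarrow> AE \<omega> in M. vec_space.rank N (\<Phi> N \<omega>) = n"
    and u_filter: "\<And>t. 1 - int n \<le> t \<Longrightarrow> AE \<omega> in M. (\<lambda>k. h k * e (t - int k) \<omega>) sums u t \<omega>"
    and h_summable: "summable (\<lambda>k. \<bar>h k\<bar>)"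
    and e_iid: "prob_space.iid M e UNIV"
    and e_mean: "\<And>t. prob_space.expectation M (e t) = 0"
    and e_var: "\<And>t. prob_space.variance M (e t) = \<sigma>\<^sub>e\<^sup>2" "0 < \<sigma>\<^sub>e\<^sup>2"
    and e_moments: "\<exists>\<delta>>0. prob_space.bounded_moments M (4 + \<delta>) e UNIV"
    and e_fourth: "\<And>t. prob_space.expectation M (\<lambda>\<omega>. e t \<omega> ^ 4) = c * \<sigma>\<^sub>e ^ 4"
    and Sigma: "\<Sigma> = prob_space.covariance_mat M n (\<lambda>i. u (int i))"
    and Sigma_pos_def: "pos_def n \<Sigma>"
    and v_iid: "prob_space.iid M v {1..}"
    and v_mean: "\<And>t. 1 \<le> t \<Longrightarrow> prob_space.expectation M (v t) = 0"
    and v_var: "\<And>t. 1 \<le> t \<Longrightarrow> prob_space.variance M (v t) = \<sigma>\<^sup>2" "0 < \<sigma>\<^sup>2"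
    and v_moments: "\<exists>\<delta>>0. prob_space.bounded_moments M (4 + \<delta>) v {1..}"
    and u_v_indep: "prob_space.indep_families M u {1 - int n..} v {1..}"
  shows "prob_space.Op_mat M {n<..} (\<lambda>N \<omega>. (\<Phi> N \<omega>)\<^sup>T * \<Phi> N \<omega>) (\<lambda>N. real N) \<and>
         prob_space.Op_real M {n<..} (\<lambda>N \<omega>. V N \<omega> \<bullet> V N \<omega>) (\<lambda>N. real N) \<and>
         prob_space.Op_mat M {n<..}
           (\<lambda>N \<omega>. (1 / real N) \<cdot>\<^sub>m ((\<Phi> N \<omega>)\<^sup>T * \<Phi> N \<omega>) - \<Sigma>) (\<lambda>N. 1 / sqrt (real N)) \<and>
         prob_space.Op_vec M {n<..}
           (\<lambda>N \<omega>. (1 / real N) \<cdot>\<^sub>v ((\<Phi> N \<omega>)\<^sup>T *\<^sub>v V N \<omega>)) (\<lambda>N. 1 / sqrt (real N)) \<and>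
         prob_space.Op_real M {n<..}
           (\<lambda>N \<omega>. (V N \<omega> \<bullet> V N \<omega>) / real N - \<sigma>\<^sup>2) (\<lambda>N. 1 / sqrt (real N)) \<and>
         prob_space.Op_vec M {n<..} (\<lambda>N \<omega>. \<theta>LS N \<omega> - \<theta>\<^sub>0) (\<lambda>N. 1 / sqrt (real N)) \<and>
         prob_space.Op_real M {n<..} (\<lambda>N \<omega>. \<sigma>2hat N \<omega> - \<sigma>\<^sup>2) (\<lambda>N. 1 / sqrt (real N))"
proof -
  interpret prob_space M by (rule M)
  let ?S = "{n<..}"
  let ?r = "\<lambda>N::nat. 1 / sqrt (real N)"
  have S: "?S \<noteq> {}" and S_pos: "\<And>N. N \<in> ?S \<Longrightarrow> 0 < N" and r_nz: "\<And>N. N \<in> ?S \<Longrightarrow> ?r N \<noteq> 0"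
    by auto

  have u_rv[measurable]: "random_variable borel (u t)" if "t \<in> {1 - int n..}" for t
    using indep_families_rv[OF u_v_indep that] .
  have e_ind: "indep_vars (\<lambda>_. borel) e UNIV" and v_ind: "indep_vars (\<lambda>_. borel) v {1..}"
    using e_iid v_iid by (simp_all add: iid_def)
  have e_rv: "random_variable borel (e t)" for t
    using e_ind by (simp add: indep_vars_def)
  have v_rv[measurable]: "random_variable borel (v t)" if "t \<in> {1..}" for t
    using v_ind that by (simp add: indep_vars_def)
  obtain \<delta>\<^sub>e where "0 < \<delta>\<^sub>e" "bounded_moments (4 + \<delta>\<^sub>e) e UNIV" using e_moments by blast
  then obtain C where C: "\<And>t. integrable M (\<lambda>\<omega>. e t \<omega> ^ 4)" "\<And>t. expectation (\<lambda>\<omega>. e t \<omega> ^ 4) \<le> C"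
    using bounded_moments_fourth[of \<delta>\<^sub>e e UNIV] e_rv by auto
  obtain \<delta>\<^sub>v where "0 < \<delta>\<^sub>v" "bounded_moments (4 + \<delta>\<^sub>v) v {1..}" using v_moments by blast
  then obtain D where D: "\<And>t. t \<in> {1..} \<Longrightarrow> integrable M (\<lambda>\<omega>. v t \<omega> ^ 4)"
      "\<And>t. t \<in> {1..} \<Longrightarrow> expectation (\<lambda>\<omega>. v t \<omega> ^ 4) \<le> D"
    using bounded_moments_fourth[of \<delta>\<^sub>v v "{1..}"] v_rv by auto

  have v_noise: "white_noise M v {1..} (\<sigma>\<^sup>2) D"
    by unfold_locales (use v_ind v_mean v_var(1) D in auto)
  interpret v: white_noise M v "{1..}" "\<sigma>\<^sup>2" D by (rule v_noise)
  interpret u: linear_process M e "\<sigma>\<^sub>e\<^sup>2" C h u "{1 - int n..}"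
    by unfold_locales (use e_ind e_mean e_var(1) C h_summable u_rv u_filter in auto)

  have Phi_rm: "random_mat M N n (\<Phi> N)" for N
    unfolding random_mat_def Phi
    by (auto simp: regressor_mat_carrier regressor_mat_index intro!: u_rv)
  have V_rv: "random_vec M N (V N)" for N
    unfolding random_vec_def V by (auto simp: noise_vec_carrier) (auto simp: noise_vec_def intro!: v_rv)
  note Phi_c = random_matD(1)[OF Phi_rm] and V_c = random_vecD(1)[OF V_rv]
  have Y_rv: "random_vec M N (Y N)" for N
    unfolding Y by (intro random_vec_plus random_vec_mult_mat_vec[OF Phi_rm] random_vec_const theta0 V_rv)
  have G_rm: "random_mat M n n (\<lambda>\<omega>. (\<Phi> N \<omega>)\<^sup>T * \<Phi> N \<omega>)" for N
    by (rule random_mat_mult[OF random_mat_transpose[OF Phi_rm] Phi_rm])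
  have W_rv: "random_vec M n (\<lambda>\<omega>. (\<Phi> N \<omega>)\<^sup>T *\<^sub>v V N \<omega>)" for N
    by (rule random_vec_mult_mat_vec[OF random_mat_transpose[OF Phi_rm] V_rv])
  have LS_rv: "random_vec M n (\<theta>LS N)" for N
    unfolding theta_LS by (rule random_vec_ls_estimator[OF Phi_rm Y_rv])
  have Sigma_c: "\<Sigma> \<in> carrier_mat n n" using Sigma_pos_def by (simp add: pos_def_def)

  \<comment> \<open>The entry at \<open>(i, j)\<close> belongs to the regressor lags \<open>i + 1\<close> and \<open>j + 1\<close>, and covariances depend on the
      lag difference only.\<close>
  have Sigma_index: "\<Sigma> $$ (i, j) = u.acov (int (j + 1) - int (i + 1))" if "i < n" "j < n" for i j
  proof -
    have ij: "int i \<in> {1 - int n..}" "int j \<in> {1 - int n..}" using that by auto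
    have "\<Sigma> $$ (i, j) = expectation (\<lambda>\<omega>. u (int j) \<omega> * u (int i) \<omega>)"
      using that by (simp add: Sigma covariance_mat_def covariance_def u.mean_u[OF ij(1)] u.mean_u[OF ij(2)] mult.commute)
    then show ?thesis using u.expectation_uu[OF ij(2,1)] by simp
  qed

  have G_comp: "Op_real ?S (\<lambda>N \<omega>. ((\<Phi> N \<omega>)\<^sup>T * \<Phi> N \<omega>) $$ (i, j) / N - \<Sigma> $$ (i, j)) ?r"
    if ij: "i < n" "j < n" for i j
  proof -
    let ?X = "\<lambda>N \<omega>. \<Sum>t\<in>{1..int N}. u (t - int (i + 1)) \<omega> * u (t - int (j + 1)) \<omega>
      - u.acov (int (j + 1) - int (i + 1))"
    have T: "t - int (i + 1) \<in> {1 - int n..}" "t - int (j + 1) \<in> {1 - int n..}"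
      if "t \<in> {1..int N}" for t N
      using that ij by auto
    have moment: "integrable M (\<lambda>\<omega>. (?X N \<omega>)\<^sup>2)"
      "expectation (\<lambda>\<omega>. (?X N \<omega>)\<^sup>2) \<le> u.H ^ 4 * (card {1..int N} * C)" for N
      by (rule u.sample_autocov(1)[OF finite_atLeastAtMost_int], erule T(1), erule T(2),
          rule u.sample_autocov(2)[OF finite_atLeastAtMost_int], erule T(1), erule T(2))
    have "Op_real ?S (\<lambda>N \<omega>. ?X N \<omega> / N) ?r"
    proof (rule Op_real_mean[OF S S_pos, where C = "u.H ^ 4 * C"])
      show "random_variable borel (?X N)" for N
        using T by (intro borel_measurable_sum borel_measurable_diff borel_measurable_times u_rv
            borel_measurable_const) auto
      show "integrable M (\<lambda>\<omega>. (?X N \<omega>)\<^sup>2)" for N by (rule moment(1))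
      show "expectation (\<lambda>\<omega>. (?X N \<omega>)\<^sup>2) \<le> N * (u.H ^ 4 * C)" for N
        using moment(2)[of N] by (simp add: mult_ac)
    qed
    moreover have "((\<Phi> N \<omega>)\<^sup>T * \<Phi> N \<omega>) $$ (i, j) / N - \<Sigma> $$ (i, j) = ?X N \<omega> / N"
      if "N \<in> ?S" for N \<omega>
      using S_pos[OF that] by (simp add: Phi gram_index[OF ij] Sigma_index[OF ij] sum_subtractf diff_divide_distrib)
    ultimately show ?thesis by (rule Op_real_cong[THEN iffD2, rotated])
  qed
  have W_comp: "Op_real ?S (\<lambda>N \<omega>. ((1 / real N) \<cdot>\<^sub>v ((\<Phi> N \<omega>)\<^sup>T *\<^sub>v V N \<omega>)) $ i) ?r"
    if i: "i < n" for i
  proof -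
    let ?X = "\<lambda>N \<omega>. \<Sum>t\<in>{1..int N}. u (t - int (i + 1)) \<omega> * v t \<omega>"
    have T: "t - int (i + 1) \<in> {1 - int n..}" "t \<in> {1..}" if "t \<in> {1..int N}" for t N
      using that i by auto
    have moment: "integrable M (\<lambda>\<omega>. (?X N \<omega>)\<^sup>2)"
      "expectation (\<lambda>\<omega>. (?X N \<omega>)\<^sup>2) \<le> card {1..int N} * (u.acov 0 * \<sigma>\<^sup>2)" for N
      by (rule u.cross_moment_sum(1)[OF v_noise u_v_indep finite_atLeastAtMost_int], erule T(1), erule T(2),
          rule u.cross_moment_sum(2)[OF v_noise u_v_indep finite_atLeastAtMost_int], erule T(1), erule T(2))
    have "Op_real ?S (\<lambda>N \<omega>. ?X N \<omega> / N) ?r"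
    proof (rule Op_real_mean[OF S S_pos, where C = "u.acov 0 * \<sigma>\<^sup>2"])
      show "random_variable borel (?X N)" for N
        using T by (intro borel_measurable_sum borel_measurable_times u_rv v_rv) auto
      show "integrable M (\<lambda>\<omega>. (?X N \<omega>)\<^sup>2)" for N by (rule moment(1))
      show "expectation (\<lambda>\<omega>. (?X N \<omega>)\<^sup>2) \<le> N * (u.acov 0 * \<sigma>\<^sup>2)" for N
        using moment(2)[of N] by simp
    qed
    moreover have "((1 / real N) \<cdot>\<^sub>v ((\<Phi> N \<omega>)\<^sup>T *\<^sub>v V N \<omega>)) $ i = ?X N \<omega> / N" if "N \<in> ?S" for N \<omega>
      using i random_vecD(2)[OF W_rv, of N \<omega>] cross_index[OF i, of u N \<omega> v] by (simp add: Phi V)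
    ultimately show ?thesis by (rule Op_real_cong[THEN iffD2, rotated])
  qed
  have VV: "Op_real ?S (\<lambda>N \<omega>. (V N \<omega> \<bullet> V N \<omega>) / real N - \<sigma>\<^sup>2) ?r"
  proof -
    let ?X = "\<lambda>N \<omega>. \<Sum>t\<in>{1..int N}. v.lagged_product 0 0 t \<omega>"
    have moment: "integrable M (\<lambda>\<omega>. (?X N \<omega>)\<^sup>2)"
      "expectation (\<lambda>\<omega>. (?X N \<omega>)\<^sup>2) \<le> card {1..int N} * D" for N
      by (rule v.lagged_product_sum(1); simp) (rule v.lagged_product_sum(2); simp)
    have "Op_real ?S (\<lambda>N \<omega>. ?X N \<omega> / N) ?r"
    proof (rule Op_real_mean[OF S S_pos, where C = "D"])
      show "random_variable borel (?X N)" for N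
        unfolding v.lagged_product_def
        by (intro borel_measurable_sum borel_measurable_diff borel_measurable_times v_rv
            borel_measurable_const) auto
      show "integrable M (\<lambda>\<omega>. (?X N \<omega>)\<^sup>2)" for N by (rule moment(1))
      show "expectation (\<lambda>\<omega>. (?X N \<omega>)\<^sup>2) \<le> N * D" for N using moment(2)[of N] by simp
    qed
    moreover have "(V N \<omega> \<bullet> V N \<omega>) / real N - \<sigma>\<^sup>2 = ?X N \<omega> / N" if "N \<in> ?S" for N \<omega>
      using S_pos[OF that] by (simp add: V noise_square v.lagged_product_def sum_subtractf diff_divide_distrib)
    ultimately show ?thesis by (rule Op_real_cong[THEN iffD2, rotated])
  qed

  have G1: "Op_mat ?S (\<lambda>N \<omega>. (\<Phi> N \<omega>)\<^sup>T * \<Phi> N \<omega>) (\<lambda>N. real N)"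
  proof (rule Op_mat_componentsI[OF S G_rm])
    show "Op_real ?S (\<lambda>N \<omega>. ((\<Phi> N \<omega>)\<^sup>T * \<Phi> N \<omega>) $$ (i, j)) (\<lambda>N. real N)" if "i < n" "j < n" for i j
      by (rule Op_real_uncenter[OF S S_pos random_matD(4)[OF G_rm that] G_comp[OF that]])
  qed auto
  have VV1: "Op_real ?S (\<lambda>N \<omega>. V N \<omega> \<bullet> V N \<omega>) (\<lambda>N. real N)"
    by (rule Op_real_uncenter[OF S S_pos borel_measurable_scalar_prod[OF V_rv V_rv] VV])
  have G2: "Op_mat ?S (\<lambda>N \<omega>. (1 / real N) \<cdot>\<^sub>m ((\<Phi> N \<omega>)\<^sup>T * \<Phi> N \<omega>) - \<Sigma>) ?r"
  proof (rule Op_mat_componentsI[OF S _ r_nz])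
    show "random_mat M n n (\<lambda>\<omega>. (1 / real N) \<cdot>\<^sub>m ((\<Phi> N \<omega>)\<^sup>T * \<Phi> N \<omega>) - \<Sigma>)" for N
      by (intro random_mat_minus random_mat_smult G_rm random_mat_const Sigma_c) simp
    show "Op_real ?S (\<lambda>N \<omega>. ((1 / real N) \<cdot>\<^sub>m ((\<Phi> N \<omega>)\<^sup>T * \<Phi> N \<omega>) - \<Sigma>) $$ (i, j)) ?r"
      if "i < n" "j < n" for i j
      using G_comp[OF that] that random_matD(2,3)[OF G_rm] Sigma_c by simp
  qed
  have W: "Op_vec ?S (\<lambda>N \<omega>. (1 / real N) \<cdot>\<^sub>v ((\<Phi> N \<omega>)\<^sup>T *\<^sub>v V N \<omega>)) ?r"
    by (rule Op_vec_componentsI[OF S random_vec_smult[OF W_rv] r_nz W_comp]) simp_all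

  \<comment> \<open>The same bounds as tight families of norms, the form in which the estimators use them.\<close>
  have b_G: "bounded_in_prob ?S (\<lambda>N \<omega>. frobenius_norm ((1 / real N) \<cdot>\<^sub>m ((\<Phi> N \<omega>)\<^sup>T * \<Phi> N \<omega>)))"
    using G1 by (simp add: Op_mat_def)
  have b_D: "bounded_in_prob ?S
      (\<lambda>N \<omega>. sqrt N * frobenius_norm ((1 / real N) \<cdot>\<^sub>m ((\<Phi> N \<omega>)\<^sup>T * \<Phi> N \<omega>) - \<Sigma>))"
    using G2 by (simp add: Op_mat_def frobenius_norm_smult)
  have b_W: "bounded_in_prob ?S (\<lambda>N \<omega>. sqrt N * vec_norm ((1 / real N) \<cdot>\<^sub>v ((\<Phi> N \<omega>)\<^sup>T *\<^sub>v V N \<omega>)))"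
    using W unfolding Op_vec_def vec_norm_smult[of "1 / (1 / sqrt _)"] by simp
  have b_V: "bounded_in_prob ?S (\<lambda>N \<omega>. sqrt N * \<bar>(V N \<omega> \<bullet> V N \<omega>) / real N - \<sigma>\<^sup>2\<bar>)"
    using VV by (simp add: Op_real_def abs_mult mult.commute)

  obtain B where B: "B \<in> carrier_mat n n" "B * \<Sigma> = 1\<^sub>m n"
    using pos_def_left_inverse[OF Sigma_pos_def] by blast
  have d_rv: "random_vec M n (\<lambda>\<omega>. \<theta>LS N \<omega> - \<theta>\<^sub>0)" for N
    by (intro random_vec_minus LS_rv random_vec_const theta0)
  have b_d: "bounded_in_prob ?S (\<lambda>N \<omega>. sqrt N * vec_norm (\<theta>LS N \<omega> - \<theta>\<^sub>0))"
  proof (rule bounded_in_prob_dominated_whp[OF S])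
    show "random_variable borel (\<lambda>\<omega>. sqrt N * vec_norm (\<theta>LS N \<omega> - \<theta>\<^sub>0))" for N
      using borel_measurable_vec_norm[OF d_rv[of N]] by simp
    let ?Y = "\<lambda>N \<omega>. 2 * frobenius_norm B * (sqrt N * vec_norm ((1 / real N) \<cdot>\<^sub>v ((\<Phi> N \<omega>)\<^sup>T *\<^sub>v V N \<omega>)))"
    show b_Y: "bounded_in_prob ?S ?Y"
      by (intro bounded_in_prob_mult[OF S] bounded_in_prob_const[OF S] b_W)
         (simp_all add: frobenius_norm_nonneg vec_norm_nonneg)
    fix \<epsilon> :: real assume "0 < \<epsilon>"
    \<comment> \<open>A threshold with \<open>\<parallel>B\<parallel> k \<le> 1/2\<close> that is meaningful also for \<open>\<parallel>B\<parallel> = 0\<close>.\<close>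
    define k where "k = 1 / (2 * frobenius_norm B + 1)"
    have k: "0 < k" "frobenius_norm B * k \<le> 1 / 2"
      using frobenius_norm_nonneg[of B] by (auto simp: k_def field_simps add_nonneg_pos)
    let ?D = "\<lambda>N \<omega>. (1 / real N) \<cdot>\<^sub>m ((\<Phi> N \<omega>)\<^sup>T * \<Phi> N \<omega>) - \<Sigma>"
    have "filterlim (\<lambda>N. sqrt (real N)) at_top sequentially" 
      by (rule filterlim_compose[OF sqrt_at_top filterlim_real_sequentially])
    from bounded_in_prob_scaled_imp_small_whp[OF b_D this k(1) \<open>0 < \<epsilon>\<close>]
    obtain N\<^sub>0 where N\<^sub>0: "\<And>N. N \<in> ?S \<Longrightarrow> N\<^sub>0 \<le> N \<Longrightarrow>
        prob {\<omega> \<in> space M. frobenius_norm (?D N \<omega>) > k} \<le> \<epsilon>"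
      by blast
    have "prob {\<omega> \<in> space M. sqrt N * vec_norm (\<theta>LS N \<omega> - \<theta>\<^sub>0) > ?Y N \<omega>} \<le> \<epsilon>"
      if N: "N \<in> ?S" "N\<^sub>0 \<le> N" for N
    proof -
      have bound: "sqrt N * vec_norm (\<theta>LS N \<omega> - \<theta>\<^sub>0) \<le> ?Y N \<omega>"
        if "frobenius_norm (?D N \<omega>) \<le> k" for \<omega>
      proof -
        have "frobenius_norm B * frobenius_norm (?D N \<omega>) \<le> 1 / 2"
          using mult_left_mono[OF that frobenius_norm_nonneg[of B]] k(2) by linarith
        then have "vec_norm (\<theta>LS N \<omega> - \<theta>\<^sub>0)
            \<le> 2 * frobenius_norm B * vec_norm ((1 / real N) \<cdot>\<^sub>v ((\<Phi> N \<omega>)\<^sup>T *\<^sub>v V N \<omega>))"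
          unfolding theta_LS Y using S_pos[OF N(1)]
          by (intro ls_estimator_error_bound[OF Phi_c theta0 V_c B(1) Sigma_c B(2)]) auto
        then have "sqrt N * vec_norm (\<theta>LS N \<omega> - \<theta>\<^sub>0)
            \<le> sqrt N * (2 * frobenius_norm B * vec_norm ((1 / real N) \<cdot>\<^sub>v ((\<Phi> N \<omega>)\<^sup>T *\<^sub>v V N \<omega>)))"
          by (rule mult_left_mono) simp
        then show ?thesis by (simp only: mult_ac)
      qed
      have "random_mat M n n (?D N)"
        by (intro random_mat_minus random_mat_smult G_rm random_mat_const Sigma_c) simp
      note [measurable] = borel_measurable_frobenius_norm[OF this]
      have "prob {\<omega> \<in> space M. sqrt N * vec_norm (\<theta>LS N \<omega> - \<theta>\<^sub>0) > ?Y N \<omega>}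
          \<le> prob {\<omega> \<in> space M. frobenius_norm (?D N \<omega>) > k}"
      proof (rule finite_measure_mono)
        show "{\<omega> \<in> space M. frobenius_norm (?D N \<omega>) > k} \<in> sets M" by measurable
        show "{\<omega> \<in> space M. sqrt N * vec_norm (\<theta>LS N \<omega> - \<theta>\<^sub>0) > ?Y N \<omega>}
            \<subseteq> {\<omega> \<in> space M. frobenius_norm (?D N \<omega>) > k}"
        proof (rule Collect_mono, rule impI, erule conjE, rule conjI)
          fix \<omega> assume "sqrt N * vec_norm (\<theta>LS N \<omega> - \<theta>\<^sub>0) > ?Y N \<omega>"
          then show "frobenius_norm (?D N \<omega>) > k"
            using bound[of \<omega>] by linarith
        qed
      qed
      then show ?thesis using N\<^sub>0[OF N] by linarith
    qed
    then show "\<exists>N\<^sub>0. \<forall>N\<in>?S. N\<^sub>0 \<le> N \<longrightarrow>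
        prob {\<omega> \<in> space M. sqrt N * vec_norm (\<theta>LS N \<omega> - \<theta>\<^sub>0) > ?Y N \<omega>} \<le> \<epsilon>"
      by blast
  qed
  have LS: "Op_vec ?S (\<lambda>N \<omega>. \<theta>LS N \<omega> - \<theta>\<^sub>0) ?r"
    using b_d r_nz unfolding Op_vec_def vec_norm_smult by simp

  have sig: "Op_real ?S (\<lambda>N \<omega>. \<sigma>2hat N \<omega> - \<sigma>\<^sup>2) ?r"
  proof -
    let ?d = "\<lambda>N \<omega>. sqrt N * vec_norm (\<theta>LS N \<omega> - \<theta>\<^sub>0)"
    let ?w = "\<lambda>N \<omega>. sqrt N * vec_norm ((1 / real N) \<cdot>\<^sub>v ((\<Phi> N \<omega>)\<^sup>T *\<^sub>v V N \<omega>))"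
    let ?g = "\<lambda>N \<omega>. frobenius_norm ((1 / real N) \<cdot>\<^sub>m ((\<Phi> N \<omega>)\<^sup>T * \<Phi> N \<omega>))"
    let ?v = "\<lambda>N \<omega>. sqrt N * \<bar>(V N \<omega> \<bullet> V N \<omega>) / real N - \<sigma>\<^sup>2\<bar>"
    have "bounded_in_prob ?S (\<lambda>N \<omega>. sqrt N * \<bar>\<sigma>2hat N \<omega> - \<sigma>\<^sup>2\<bar>)"
    proof (rule bounded_in_prob_mono[OF S])
      show "random_variable borel (\<lambda>\<omega>. sqrt N * \<bar>\<sigma>2hat N \<omega> - \<sigma>\<^sup>2\<bar>)" for N
      proof -
        have "random_vec M N (\<lambda>\<omega>. Y N \<omega> - \<Phi> N \<omega> *\<^sub>v \<theta>LS N \<omega>)"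
          by (intro random_vec_minus Y_rv random_vec_mult_mat_vec[OF Phi_rm] LS_rv)
        note [measurable] = borel_measurable_vec_norm[OF this]
        show ?thesis
          unfolding sigma2_hat noise_var_estimator_def random_matD(2,3)[OF Phi_rm] theta_LS[THEN fun_cong, THEN fun_cong, symmetric]
          by measurable
      qed
      have nn: "0 \<le> ?d N \<omega>" "0 \<le> ?w N \<omega>" "0 \<le> ?g N \<omega>" "0 \<le> ?v N \<omega>" for N \<omega>
        by (simp_all add: vec_norm_nonneg frobenius_norm_nonneg)
      have dw_nn: "0 \<le> ?d N \<omega> * ?w N \<omega>" and dd_nn: "0 \<le> ?d N \<omega> * ?d N \<omega>"
        and ddg_nn: "0 \<le> ?d N \<omega> * ?d N \<omega> * ?g N \<omega>" for N \<omega>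
        by (simp_all add: vec_norm_nonneg frobenius_norm_nonneg)
      note const = bounded_in_prob_const[OF S]
      have "bounded_in_prob ?S (\<lambda>N \<omega>. ?d N \<omega> * ?w N \<omega>)"
        by (rule bounded_in_prob_mult[OF S b_d b_W nn(1) nn(2)])
      then have dw: "bounded_in_prob ?S (\<lambda>N \<omega>. 2 * (?d N \<omega> * ?w N \<omega>))"
        by (rule bounded_in_prob_mult[OF S const _ _ dw_nn]) simp
      have "bounded_in_prob ?S (\<lambda>N \<omega>. ?d N \<omega> * ?d N \<omega>)"
        by (rule bounded_in_prob_mult[OF S b_d b_d nn(1) nn(1)])
      then have ddg: "bounded_in_prob ?S (\<lambda>N \<omega>. ?d N \<omega> * ?d N \<omega> * ?g N \<omega>)"
        by (rule bounded_in_prob_mult[OF S _ b_G dd_nn nn(3)])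
      have "bounded_in_prob ?S (\<lambda>N \<omega>. ?v N \<omega> + 2 * (?d N \<omega> * ?w N \<omega>) + ?d N \<omega> * ?d N \<omega> * ?g N \<omega>)"
        by (rule bounded_in_prob_add[OF S bounded_in_prob_add[OF S b_V dw] ddg])
      then have "bounded_in_prob ?S (\<lambda>N \<omega>. real (n + 1) * (?v N \<omega> + 2 * (?d N \<omega> * ?w N \<omega>)
          + ?d N \<omega> * ?d N \<omega> * ?g N \<omega>))"
      proof (rule bounded_in_prob_mult[OF S const])
        show "0 \<le> ?v N \<omega> + 2 * (?d N \<omega> * ?w N \<omega>) + ?d N \<omega> * ?d N \<omega> * ?g N \<omega>" for N \<omega>
          using nn(4)[of N \<omega>] dw_nn[of N \<omega>] ddg_nn[of N \<omega>] by linarith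
      qed simp
      then show "bounded_in_prob ?S (\<lambda>N \<omega>. real (n + 1) * (?v N \<omega> + 2 * (?d N \<omega> * ?w N \<omega>)
          + ?d N \<omega> * ?d N \<omega> * ?g N \<omega>) + \<sigma>\<^sup>2 * n * real (n + 1))"
        by (rule bounded_in_prob_add[OF S _ const])
      fix N \<omega> assume "N \<in> ?S"
      then show "sqrt N * \<bar>\<sigma>2hat N \<omega> - \<sigma>\<^sup>2\<bar> \<le> real (n + 1) * (?v N \<omega> + 2 * (?d N \<omega> * ?w N \<omega>)
          + ?d N \<omega> * ?d N \<omega> * ?g N \<omega>) + \<sigma>\<^sup>2 * n * real (n + 1)"
        unfolding sigma2_hat
        by (intro noise_var_estimator_error_bound[OF Phi_c theta0 V_c]) (auto simp: theta_LS Y)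
    qed
    then show ?thesis by (simp add: Op_real_def abs_mult mult.commute)
  qed

  show ?thesis
    using G1 VV1 G2 W VV LS sig by blast
qed

end
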